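(* There is an algorithm which, for every $n\ge 1$ and every set $P$ of $2n$ distinct points lying on a circle in the plane ($n$ of them red and $n$ of them blue), given as the list of points in counterclockwise order around the circle together with their coordinates and colors, finds a bottleneck matching of $P$ in $O(n)$ time.
   Context: A matching of $P$ (bichromatic, perfect, non-crossing) is a set $M$ of $n$ straight line segments such that each point of $P$ is an endpoint of exactly one segment, each segment has one red and one blue endpoint, and no two segments cross. The value of $M$, denoted $\mathrm{bn}(M)$, is the Euclidean length of a longest segment in $M$. A bottleneck matching of $P$ is a matching $M$ minimizing $\mathrm{bn}(M)$ among all matchings of $P$. The model of computation is the usual real-RAM model of computational geometry (arithmetic operations and comparisons on real numbers, and evaluation of the distance between two points, take unit time). *)

theory Defs
  imports "HOL-Analysis.Analysis" "HOL-Library.Landau_Symbols"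
begin

type_synonym point = "real \<times> real"

datatype colour = Red | Blue

definition points_of :: "colour \<Rightarrow> (point \<times> colour) list \<Rightarrow> point set" where
  "points_of k ps = {p. (p, k) \<in> set ps}"

definition ccw_on_circle :: "point list \<Rightarrow> bool" where
  "ccw_on_circle qs \<longleftrightarrow>
     (\<exists>c r \<theta>. r > 0 \<and>
        (\<forall>i<length qs. qs ! i = c + r *\<^sub>R (cos (\<theta> i), sin (\<theta> i))) \<and>
        strict_mono_on {..<length qs} \<theta> \<and>
        (\<forall>i<length qs. \<theta> i < \<theta> 0 + 2 * pi))"

definition valid_instance :: "nat \<Rightarrow> (point \<times> colour) list \<Rightarrow> bool" where
  "valid_instance n ps \<longleftrightarrow>
     length ps = 2 * n \<and>
     distinct (map fst ps) \<and>
     count_list (map snd ps) Red = n \<and>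
     count_list (map snd ps) Blue = n \<and>
     ccw_on_circle (map fst ps)"

text \<open>
  A segment with one red and one blue endpoint is represented by the pair
  (red endpoint, blue endpoint).
\<close>

definition seg :: "point \<times> point \<Rightarrow> point set" where
  "seg e = closed_segment (fst e) (snd e)"

text \<open>
  Distinct segments of a perfect matching have four distinct endpoints.  If these
  lie on a circle, no endpoint of one segment lies on the other one, so two
  segments cross iff they have a point in common.
\<close>

definition is_matching :: "point set \<Rightarrow> point set \<Rightarrow> (point \<times> point) set \<Rightarrow> bool" where
  "is_matching R B M \<longleftrightarrow>
     M \<subseteq> R \<times> B \<and>
     (\<forall>p\<in>R \<union> B. \<exists>!e. e \<in> M \<and> p \<in> {fst e, snd e}) \<and>
     pairwise (\<lambda>e f. disjnt (seg e) (seg f)) M"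

definition bn :: "(point \<times> point) set \<Rightarrow> real" where
  "bn M = Max ((\<lambda>e. dist (fst e) (snd e)) ` M)"

definition is_bottleneck_matching :: "point set \<Rightarrow> point set \<Rightarrow> (point \<times> point) set \<Rightarrow> bool" where
  "is_bottleneck_matching R B M \<longleftrightarrow> is_arg_min bn (is_matching R B) M"

text \<open>
  A program is a finite list of instructions over a memory of real-valued cells,
  with indirect addressing, a read-only input tape and a write-only output tape.
  Operands are cell addresses; for arithmetic instructions the first operand is the
  destination.  Each instruction takes unit time.  A machine gets stuck (and then
  computes nothing) on division by zero, on indirect addressing through a cell whose
  content is not a natural number, on reading past the end of the input, and on
  leaving the program other than through \<^term>\<open>Halt\<close>.  The only literal constants
  are integers, and there is no rounding instruction.
\<close>

datatype instr =
    Const nat int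
  | Copy nat nat
  | Add nat nat nat
  | Sub nat nat nat
  | Mul nat nat nat
  | Div nat nat nat
  | Dist nat nat nat nat nat
  | Load nat nat
  | Store nat nat
  | Read nat
  | Write nat
  | Jump nat
  | JumpLe nat nat nat
  | Halt

type_synonym program = "instr list"

record state =
  pc :: nat
  mem :: "nat \<Rightarrow> real"
  inp :: "real list"
  out :: "real list"

definition initial :: "real list \<Rightarrow> state" where
  "initial xs = \<lparr>pc = 0, mem = (\<lambda>_. 0), inp = xs, out = []\<rparr>"

definition put :: "nat \<Rightarrow> real \<Rightarrow> state \<Rightarrow> state" where
  "put a v s = s\<lparr>pc := Suc (pc s), mem := (mem s)(a := v)\<rparr>"

fun exec :: "instr \<Rightarrow> state \<Rightarrow> state option" where
  "exec (Const d k) s = Some (put d (of_int k) s)"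
| "exec (Copy d a) s = Some (put d (mem s a) s)"
| "exec (Add d a b) s = Some (put d (mem s a + mem s b) s)"
| "exec (Sub d a b) s = Some (put d (mem s a - mem s b) s)"
| "exec (Mul d a b) s = Some (put d (mem s a * mem s b) s)"
| "exec (Div d a b) s = (if mem s b = 0 then None else Some (put d (mem s a / mem s b) s))"
| "exec (Dist d x y x' y') s = Some (put d (dist (mem s x, mem s y) (mem s x', mem s y')) s)"
| "exec (Load d a) s =
     (if mem s a \<in> \<nat> then Some (put d (mem s (nat \<lfloor>mem s a\<rfloor>)) s) else None)"
| "exec (Store a b) s =
     (if mem s a \<in> \<nat> then Some (put (nat \<lfloor>mem s a\<rfloor>) (mem s b) s) else None)"
| "exec (Read d) s =
     (case inp s of [] \<Rightarrow> None | x # xs \<Rightarrow> Some (put d x (s\<lparr>inp := xs\<rparr>)))"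
| "exec (Write a) s = Some (s\<lparr>pc := Suc (pc s), out := out s @ [mem s a]\<rparr>)"
| "exec (Jump l) s = Some (s\<lparr>pc := l\<rparr>)"
| "exec (JumpLe a b l) s = Some (s\<lparr>pc := (if mem s a \<le> mem s b then l else Suc (pc s))\<rparr>)"
| "exec Halt s = None"

definition step :: "program \<Rightarrow> state \<Rightarrow> state \<Rightarrow> bool" where
  "step A s s' \<longleftrightarrow> pc s < length A \<and> exec (A ! pc s) s = Some s'"

definition computes_in :: "program \<Rightarrow> real list \<Rightarrow> nat \<Rightarrow> real list \<Rightarrow> bool" where
  "computes_in A xs t ys \<longleftrightarrow>
     (\<exists>s. (step A ^^ t) (initial xs) s \<and> pc s < length A \<and> A ! pc s = Halt \<and> out s = ys)"

fun colour_code :: "colour \<Rightarrow> real" where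
  "colour_code Red = 0"
| "colour_code Blue = 1"

definition encode_input :: "(point \<times> colour) list \<Rightarrow> real list" where
  "encode_input ps =
     real (length ps) # concat (map (\<lambda>((x, y), k). [x, y, colour_code k]) ps)"

text \<open>
  The output lists the segments of the matching, each exactly once and in any order,
  as pairs (index of red point, index of blue point) of positions in the input list.
\<close>

definition encode_output :: "(nat \<times> nat) list \<Rightarrow> real list" where
  "encode_output es = concat (map (\<lambda>(i, j). [real i, real j]) es)"

definition represents :: "(point \<times> colour) list \<Rightarrow> (nat \<times> nat) list \<Rightarrow> (point \<times> point) set \<Rightarrow> bool"
  where
  "represents ps es M \<longleftrightarrow>
     distinct es \<and> set es \<subseteq> {..<length ps} \<times> {..<length ps} \<and>
     M = (\<lambda>(i, j). (fst (ps ! i), fst (ps ! j))) ` set es"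

definition solves_bottleneck_in :: "program \<Rightarrow> (point \<times> colour) list \<Rightarrow> nat \<Rightarrow> bool" where
  "solves_bottleneck_in A ps t \<longleftrightarrow>
     (\<exists>es M. computes_in A (encode_input ps) t (encode_output es) \<and>
             represents ps es M \<and>
             is_bottleneck_matching (points_of Red ps) (points_of Blue ps) M)"

end

(*
  Colours drive a walk that goes up at a red point and down at a blue one, so every edge of a
  matching joins an up-step and a down-step on the same level.  For a threshold h, match on the
  levels at least h every blue point, and on the levels below h every red point, with its cyclic
  predecessor on its level; this is a non-crossing matching.  Some h is optimal: given any
  matching, let h be the height of the walk around the region that contains the centre.  The outer
  edges of this region cut off arcs of at most half a circle, and each edge of the matching for h
  lies in one of these arcs, hence is no longer than the edge cutting it off.  The length of the
  longest edge splits into one maximum per level and direction, and an optimal h is found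
  by closing in from both ends of the range of levels.
*)
theory Submission
  imports Defs
begin

text \<open>Why edges of the candidate for h respect the region around the centre: all gaps on the
  boundary of that region have the same height h, because each edge of the given matching encloses
  equally many red and blue points. Along the arc from a predecessor to its head the walk stays
  above the level for a blue head, and at or below it for a red head; so a head selected by h never
  spans a gap of height h, and its arc falls between two such gaps. The centre enters only through
  arc lengths, and no planar region is formalised: the circle is cut open before index 0, and the
  region lies directly inside the innermost edge spanning more than half a turn, or contains the cut
  if there is none. The two-ended search works because the longest edge for h is the larger of a
  quantity growing with h (red heads below h) and one shrinking with h (blue heads from h on).
  Comparing the red maximum on the lowest level of the range with the blue maximum on the highest
  discards one end without knowing the optimum.\<close>

subsection \<open>Level predecessors of a closed walk\<close>

text \<open>The update form mirrors the memory: this is a table indexed by level, initially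
  \<open>g\<close>, after the points below \<open>i\<close> have been entered.\<close>

primrec latest :: "(nat \<Rightarrow> nat) \<Rightarrow> (nat \<Rightarrow> nat) \<Rightarrow> nat \<Rightarrow> nat \<Rightarrow> nat" where
  "latest lv g 0 = g"
| "latest lv g (Suc i) = (latest lv g i)(lv i := i)"

lemma latest_cases:
  "(latest lv g i l = g l \<and> (\<forall>f<i. lv f \<noteq> l)) \<or>
   (latest lv g i l < i \<and> lv (latest lv g i l) = l \<and> (\<forall>f<i. latest lv g i l < f \<longrightarrow> lv f \<noteq> l))"
  by (induction i) (auto simp: less_Suc_eq)

locale closed_walk =
  fixes N :: nat and red :: "nat \<Rightarrow> bool" and H :: "nat \<Rightarrow> nat"
  assumes up: "\<lbrakk>i < N; red i\<rbrakk> \<Longrightarrow> H (Suc i) = Suc (H i)"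
    and down: "\<lbrakk>i < N; \<not> red i\<rbrakk> \<Longrightarrow> H i = Suc (H (Suc i))"
    and closed: "H N = H 0"
begin

definition lev :: "nat \<Rightarrow> nat" where
  "lev i = min (H i) (H (Suc i))"

lemma lev_red: "\<lbrakk>i < N; red i\<rbrakk> \<Longrightarrow> lev i = H i"
  and lev_blue: "\<lbrakk>i < N; \<not> red i\<rbrakk> \<Longrightarrow> lev i = H (Suc i)"
  by (auto simp: lev_def up down)

text \<open>A step passes the line halfway between \<open>k\<close> and \<open>k + 1\<close> only if
  its lower end is \<open>k\<close>, that is, only if its level is \<open>k\<close>.\<close>

lemma same_side:
  assumes "a \<le> b" "b \<le> N" "\<And>f. \<lbrakk>a \<le> f; f < b\<rbrakk> \<Longrightarrow> lev f \<noteq> k"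
  shows "k < H a \<longleftrightarrow> k < H b"
  using assms
proof (induction b rule: dec_induct)
  case (step b)
  then have IH: "k < H a \<longleftrightarrow> k < H b" and b: "b < N" "lev b \<noteq> k" by auto
  then show ?case
    using up[of b] down[of b] by (cases "red b") (auto simp: lev_def)
qed simp

text \<open>The inner pass leaves the last point of each level on the whole circle, so a second pass
  started from that table wraps around without a special case. The default 0 never surfaces, as the
  level of \<open>i\<close> is visited by \<open>i\<close> itself.\<close>

definition prd :: "nat \<Rightarrow> nat" where
  "prd i = latest lev (latest lev (\<lambda>_. 0) N) i (lev i)"

text \<open>The open cyclic arc from \<open>j\<close> to \<open>i\<close>. For \<open>j = i\<close>
  it is everything except \<open>i\<close>, a reading that matters until \<open>red_prd\<close>
  rules out \<open>prd i = i\<close>.\<close>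

definition inside :: "nat \<Rightarrow> nat \<Rightarrow> nat \<Rightarrow> bool" where
  "inside j i f \<longleftrightarrow> (if j < i then j < f \<and> f < i else f < N \<and> (j < f \<or> f < i))"

text \<open>Height \<open>H g\<close> belongs to the gap between the points \<open>g - 1\<close> and \<open>g\<close>.\<close>

definition gap :: "nat \<Rightarrow> nat \<Rightarrow> nat \<Rightarrow> bool" where
  "gap j i g \<longleftrightarrow> (if j < i then j < g \<and> g \<le> i else j < g \<and> g \<le> N \<or> g \<le> i)"

lemma
  assumes i: "i < N"
  shows prd_less: "prd i < N" and lev_prd: "lev (prd i) = lev i"
    and prd_inside: "inside (prd i) i f \<Longrightarrow> lev f \<noteq> lev i"
proof -
  define g where "g = latest lev (\<lambda>_. 0) N"
  have p: "prd i = latest lev g i (lev i)" by (simp add: prd_def g_def)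
  have g: "g (lev i) < N \<and> lev (g (lev i)) = lev i \<and> (\<forall>f<N. g (lev i) < f \<longrightarrow> lev f \<noteq> lev i)"
    using latest_cases[of lev "\<lambda>_. 0" N "lev i"] i unfolding g_def by auto
  have "prd i < N \<and> lev (prd i) = lev i \<and> (inside (prd i) i f \<longrightarrow> lev f \<noteq> lev i)"
    using latest_cases[of lev g i "lev i"] unfolding p[symmetric]
  proof (elim disjE conjE)
    assume *: "prd i = g (lev i)" "\<forall>f<i. lev f \<noteq> lev i"
    then have "\<not> prd i < i" using g by auto
    then show ?thesis using * g by (auto simp: inside_def)
  next
    assume "prd i < i" "lev (prd i) = lev i" "\<forall>f<i. prd i < f \<longrightarrow> lev f \<noteq> lev i"
    then show ?thesis using i by (auto simp: inside_def)
  qed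
  then show "prd i < N" "lev (prd i) = lev i" "inside (prd i) i f \<Longrightarrow> lev f \<noteq> lev i" by auto
qed

text \<open>By \<open>same_side\<close> the walk cannot pass the line just above
  \<open>lev i\<close> along the arc, so every gap there lies on the side of the gap right before
  \<open>i\<close>, which the direction of step \<open>i\<close> determines.\<close>

lemma gap_side:
  assumes i: "i < N" and g: "gap (prd i) i g"
  shows "red i \<longleftrightarrow> H g \<le> lev i"
proof -
  have end_side: "red i \<longleftrightarrow> \<not> lev i < H i"
    using i down[of i] by (cases "red i") (auto simp: lev_red lev_blue)
  have left: "lev i < H g \<longleftrightarrow> lev i < H i"
    if "g \<le> i" "\<And>f. \<lbrakk>g \<le> f; f < i\<rbrakk> \<Longrightarrow> inside (prd i) i f" for g
    using that i prd_inside by (intro same_side) auto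
  have "lev i < H g \<longleftrightarrow> lev i < H i"
  proof (cases "prd i < i \<or> g \<le> i")
    case True
    with g i show ?thesis by (intro left) (auto simp: gap_def inside_def split: if_splits)
  next
    case False
    then have *: "\<not> prd i < i" "prd i < g" "g \<le> N" using g by (auto simp: gap_def split: if_splits)
    \<comment> \<open>A wrapped arc is handled in two stretches, \<open>g\<close> to
      \<open>N\<close> and \<open>0\<close> to \<open>i\<close>, glued by
      \<open>closed\<close>.\<close>
    have "lev i < H g \<longleftrightarrow> lev i < H N"
      using * i prd_inside by (intro same_side) (auto simp: inside_def)
    also have "\<dots> \<longleftrightarrow> lev i < H 0" by (simp add: closed)
    also have "\<dots> \<longleftrightarrow> lev i < H i"
      using * i by (intro left) (auto simp: inside_def)
    finally show ?thesis .
  qed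
  with end_side show ?thesis by auto
qed

text \<open>The side of the gap right after the predecessor, known from \<open>gap_side\<close>,
  reveals the direction of that step, since it has the same level. In particular
  \<open>prd i\<close> differs from \<open>i\<close>.\<close>

lemma red_prd:
  assumes "i < N" shows "red (prd i) \<longleftrightarrow> \<not> red i"
proof -
  have "gap (prd i) i (Suc (prd i))"
    using prd_less[OF assms] by (auto simp: gap_def)
  from gap_side[OF assms this] show ?thesis
    using lev_prd[OF assms] up[OF prd_less[OF assms]] down[OF prd_less[OF assms]]
    by (cases "red (prd i)") (auto simp: lev_def)
qed

lemma inside_side:
  assumes i: "i < N" and f: "inside (prd i) i f"
  shows "if red i then lev f < lev i else lev i < lev f"
proof -
  have "gap (prd i) i f" "gap (prd i) i (Suc f)"
    using i f by (auto simp: inside_def gap_def split: if_splits)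
  from this[THEN gap_side[OF i]] show ?thesis
    using prd_inside[OF i f] by (auto simp: lev_def)
qed

text \<open>Two points with a common predecessor share a level, so one would lie strictly inside the
  arc of the other, against \<open>prd_inside\<close>.\<close>

lemma bij_prd: "bij_betw prd {..<N} {..<N}"
proof -
  have "inj_on prd {..<N}"
  proof (rule linorder_inj_onI)
    fix i k assume ik: "i < k" "i \<in> {..<N}" "k \<in> {..<N}"
    show "prd i \<noteq> prd k"
    proof
      assume eq: "prd i = prd k"
      then have l: "lev i = lev k" using ik lev_prd[of i] lev_prd[of k] by auto
      have "inside (prd i) i k \<or> inside (prd k) k i"
        using eq ik prd_less[of i] red_prd[of i] red_prd[of k]
        by (cases "prd i" i rule: linorder_cases) (auto simp: inside_def)
      then show False using l ik prd_inside[of i k] prd_inside[of k i] by auto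
    qed
  qed auto
  moreover have "prd ` {..<N} \<subseteq> {..<N}" using prd_less by auto
  ultimately show ?thesis by (simp add: bij_betw_def endo_inj_surj)
qed

text \<open>
  The head of an edge of the candidate matching for threshold \<open>h\<close>; the edge joins it to its
  predecessor on the same level.
\<close>

definition head :: "nat \<Rightarrow> nat \<Rightarrow> bool" where
  "head h i \<longleftrightarrow> (h \<le> lev i \<longleftrightarrow> \<not> red i)"

text \<open>A point ends one level edge and starts another. The later ends of these two edges have
  equal level and opposite colours, so \<open>h\<close> selects exactly one of them.\<close>

lemma head_covers:
  assumes "f < N"
  shows "\<exists>!i. i < N \<and> head h i \<and> (f = i \<or> f = prd i)"
proof -
  have "f \<in> prd ` {..<N}" using bij_prd assms by (simp add: bij_betw_def)
  then obtain k where k: "k < N" "prd k = f" by auto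
  have uniq: "k' = k" if "k' < N" "prd k' = f" for k'
    using inj_onD[OF bij_betw_imp_inj_on[OF bij_prd], of k' k] that k by simp
  have "head h k \<longleftrightarrow> \<not> head h f"
    using k red_prd[of k] lev_prd[of k] by (auto simp: head_def)
  then show ?thesis
    using k uniq assms by metis
qed

text \<open>Exactly one of \<open>c\<close> and \<open>d\<close> lies on the arc from
  \<open>prd i\<close> to \<open>i\<close>; as their levels agree, \<open>inside_side\<close> can be
  applied to whichever it is.\<close>

lemma separated_side:
  assumes i: "i < N" and ab: "{a, b} = {i, prd i}"
    and c: "a < c" "c < b" and d: "d < a \<or> b < d" "d < N" and l: "lev c = lev d"
  shows "if red i then lev c < lev i else lev i < lev c"
proof -
  from ab consider "a = i" "b = prd i" | "a = prd i" "b = i" by (auto simp: doubleton_eq_iff)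
  then show ?thesis
  proof cases
    case 1
    then have "inside (prd i) i d" using c d by (auto simp: inside_def)
    then show ?thesis using inside_side[OF i] l by simp
  next
    case 2
    then have "inside (prd i) i c" using c by (auto simp: inside_def)
    then show ?thesis using inside_side[OF i] by simp
  qed
qed

text \<open>Crossing edges separate each other's ends, so \<open>separated_side\<close> compares
  their levels twice. For heads of equal colour the comparisons contradict each other; for different
  colours they put the blue level below the red one, while \<open>h\<close> demands the
  reverse.\<close>

lemma heads_not_crossing:
  assumes ik: "i < N" "head h i" "k < N" "head h k"
    and ab: "{a, b} = {i, prd i}" and cd: "{c, d} = {k, prd k}"
  shows "\<not> (a < c \<and> c < b \<and> b < d)"
proof
  assume less: "a < c \<and> c < b \<and> b < d"
  have in_i: "x = i \<or> x = prd i" if "x \<in> {a, b}" for x using that unfolding ab by simp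
  have in_k: "x = k \<or> x = prd k" if "x \<in> {c, d}" for x using that unfolding cd by simp
  have l: "lev a = lev i" "lev b = lev i" "lev c = lev k" "lev d = lev k"
    using in_i[of a] in_i[of b] in_k[of c] in_k[of d] lev_prd ik by auto
  have "d < N" "a < N" using in_i[of a] in_k[of d] prd_less ik by auto
  then have "if red i then lev k < lev i else lev i < lev k"
      "if red k then lev i < lev k else lev k < lev i"
    using separated_side[OF ik(1) ab, of c d] separated_side[OF ik(3) cd, of b a] less l by auto
  with ik(2,4) show False
    by (cases "red i"; cases "red k"; simp add: head_def)
qed

text \<open>What ties the threshold to geometry: candidate edges are confined to arcs between gaps
  of height \<open>h\<close>.\<close>

lemma head_gap_neq:
  assumes "i < N" "head h i" "gap (prd i) i g"
  shows "H g \<noteq> h"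
  using gap_side[OF assms(1,3)] assms(2) by (auto simp: head_def)

lemma height_sum:
  assumes "b \<le> N" "a \<le> b"
  shows "int (H b) = int (H a) + (\<Sum>f\<in>{a..<b}. if red f then 1 else -1)"
  using assms(2,1)
proof (induction b rule: dec_induct)
  case (step b)
  then have "int (H b) = int (H a) + (\<Sum>f\<in>{a..<b}. if red f then 1 else -1)" "b < N" by auto
  then show ?case
    using up[of b] down[of b] step by (auto simp: sum.atLeastLessThan_Suc)
qed simp

end

section \<open>Heights along an arbitrary non-crossing matching\<close>

locale noncrossing_partner = closed_walk +
  fixes m :: "nat \<Rightarrow> nat"
  assumes m_less: "i < N \<Longrightarrow> m i < N"
    and m_m: "i < N \<Longrightarrow> m (m i) = i"
    and m_red: "i < N \<Longrightarrow> red (m i) \<longleftrightarrow> \<not> red i"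
    and m_noncrossing: "\<lbrakk>a < N; c < N; a < c; c < m a; m a < m c\<rbrakk> \<Longrightarrow> False"
begin

lemma m_between:
  assumes "u < m u" "m u < N" "u < f" "f < m u"
  shows "u < m f \<and> m f < m u"
proof -
  have u: "u < N" "f < N" using assms by auto
  have "m f \<noteq> u" "m f \<noteq> m u" using m_m[OF u(1)] m_m[OF u(2)] assms by auto
  moreover have "\<not> m u < m f" using m_noncrossing[of u f] u assms by auto
  moreover have "\<not> m f < u"
    using m_noncrossing[of "m f" u] m_m[OF u(2)] m_less[OF u(2)] u assms by auto
  ultimately show ?thesis by auto
qed

text \<open>\<open>m\<close> permutes the points strictly between \<open>u\<close> and
  \<open>m u\<close> and reverses their steps, so these steps cancel.\<close>

lemma balanced:
  assumes "u < m u" "m u < N"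
  shows "H (Suc u) = H (m u)" and "H (Suc (m u)) = H u"
proof -
  let ?s = "\<lambda>f. if red f then 1 else - 1 :: int" and ?I = "{Suc u..<m u}"
  have mem: "f < N \<and> m f \<in> ?I \<and> m (m f) = f" if "f \<in> ?I" for f
    using that m_between[of u f] m_m[of f] assms by auto
  have "sum ?s ?I = (\<Sum>f\<in>?I. ?s (m f))"
    using mem by (intro sum.reindex_bij_witness[of _ m m]) auto
  also have "\<dots> = (\<Sum>f\<in>?I. - ?s f)"
    using mem m_red by (intro sum.cong) auto
  finally have "sum ?s ?I = 0" by (simp add: sum_negf)
  then show *: "H (Suc u) = H (m u)"
    using height_sum[of "m u" "Suc u"] assms by simp
  show "H (Suc (m u)) = H u"
    using * m_red[of u] up[of u] up[of "m u"] down[of u] down[of "m u"] assms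
    by (metis Suc_inject less_trans)
qed

text \<open>Scan the outermost edges inside \<open>{s..<t}\<close> from left to right. By
  \<open>balanced\<close> the walk is back at height \<open>h\<close> after each of them, and no gap
  of height \<open>h\<close> occurs after \<open>j\<close> up to \<open>i\<close>; hence the first
  edge that reaches \<open>j\<close> also reaches \<open>i\<close>.\<close>

lemma covering_edge:
  assumes "s \<le> j" "j < i" "i < t" "t \<le> N" "H s = h"
    and "\<And>f. \<lbrakk>s \<le> f; f < t\<rbrakk> \<Longrightarrow> s \<le> m f \<and> m f < t"
    and "\<And>g. \<lbrakk>j < g; g \<le> i\<rbrakk> \<Longrightarrow> H g \<noteq> h"
  shows "\<exists>u. s \<le> u \<and> u \<le> j \<and> i \<le> m u \<and> m u < t"
  using assms
proof (induction "t - s" arbitrary: s rule: less_induct)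
  case less
  have s: "s < m s" "m s < t" "s < N"
  proof -
    show "m s < t" "s < N" using less.prems by auto
    have "m s \<noteq> s" using m_red[of s] less.prems by auto
    moreover have "s \<le> m s" using less.prems(6)[of s] less.prems(1-3) by linarith
    ultimately show "s < m s" by simp
  qed
  show ?case
  proof (cases "j \<le> m s")
    case True
    have "i \<le> m s"
    proof (rule ccontr)
      assume "\<not> i \<le> m s"
      with True have "j < Suc (m s)" "Suc (m s) \<le> i" by auto
      from less.prems(7)[OF this] show False using balanced(2)[of s] s less.prems(4,5) by simp
    qed
    then show ?thesis using s less.prems(1) by blast
  next
    case False
    have inner: "Suc (m s) \<le> m f \<and> m f < t" if f: "Suc (m s) \<le> f" "f < t" for f
    proof -
      have fN: "f < N" using f(2) less.prems(4) by simp
      have "m f \<noteq> s" "m f \<noteq> m s" using m_m[OF fN] m_m[OF s(3)] f(1) s(1) by auto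
      moreover have "\<not> (s < m f \<and> m f < m s)"
        using m_between[of s "m f"] m_m[OF fN] f(1) s less.prems(4) by auto
      moreover have "s \<le> m f" "m f < t" using less.prems(6)[of f] f s by auto
      ultimately show ?thesis by linarith
    qed
    have "H (Suc (m s)) = h" using balanced(2)[of s] s less.prems(4,5) by simp
    moreover have "t - Suc (m s) < t - s" using s by simp
    moreover have "Suc (m s) \<le> j" using False by simp
    ultimately have "\<exists>u. Suc (m s) \<le> u \<and> u \<le> j \<and> i \<le> m u \<and> m u < t"
      using less.hyps[of "Suc (m s)"] inner less.prems(2-4,7) by blast
    then show ?thesis using s(1) by (meson Suc_leD less_imp_le le_trans)
  qed
qed

end

subsection \<open>Chords of a circle\<close>

text \<open>In terms of half sum and half difference the squared chord length factors by pure
  algebra.\<close>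

lemma cos_sin_halves:
  fixes a t :: real
  shows "cos a = cos ((a + t) / 2) * cos ((a - t) / 2) - sin ((a + t) / 2) * sin ((a - t) / 2)"
    and "cos t = cos ((a + t) / 2) * cos ((a - t) / 2) + sin ((a + t) / 2) * sin ((a - t) / 2)"
    and "sin a = sin ((a + t) / 2) * cos ((a - t) / 2) + cos ((a + t) / 2) * sin ((a - t) / 2)"
    and "sin t = sin ((a + t) / 2) * cos ((a - t) / 2) - cos ((a + t) / 2) * sin ((a - t) / 2)"
proof -
  have a: "a = (a + t) / 2 + (a - t) / 2" and t: "t = (a + t) / 2 - (a - t) / 2"
    by (simp_all add: field_simps)
  show "cos a = cos ((a + t) / 2) * cos ((a - t) / 2) - sin ((a + t) / 2) * sin ((a - t) / 2)"
    by (subst a, rule cos_add)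
  show "cos t = cos ((a + t) / 2) * cos ((a - t) / 2) + sin ((a + t) / 2) * sin ((a - t) / 2)"
    by (subst t, rule cos_diff)
  show "sin a = sin ((a + t) / 2) * cos ((a - t) / 2) + cos ((a + t) / 2) * sin ((a - t) / 2)"
    by (subst a, rule sin_add)
  show "sin t = sin ((a + t) / 2) * cos ((a - t) / 2) - cos ((a + t) / 2) * sin ((a - t) / 2)"
    by (subst t, rule sin_diff)
qed

definition circ :: "point \<Rightarrow> real \<Rightarrow> real \<Rightarrow> point" where
  "circ c r t = c + r *\<^sub>R (cos t, sin t)"

lemma circ_periodic: "circ c r (t + 2 * pi) = circ c r t"
  by (simp add: circ_def)

lemma dist_circ:
  assumes "r > 0"
  shows "dist (circ c r a) (circ c r b) = 2 * r * \<bar>sin ((a - b) / 2)\<bar>"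
proof -
  have "(r * (cos a - cos b))\<^sup>2 + (r * (sin a - sin b))\<^sup>2 = (2 * r * sin ((a - b) / 2))\<^sup>2"
  proof -
    have "(cos a - cos b)\<^sup>2 + (sin a - sin b)\<^sup>2
        = 4 * (sin ((a - b) / 2))\<^sup>2 * ((sin ((a + b) / 2))\<^sup>2 + (cos ((a + b) / 2))\<^sup>2)"
      unfolding cos_sin_halves[where a = a and t = b] by algebra
    then have "(cos a - cos b)\<^sup>2 + (sin a - sin b)\<^sup>2 = 4 * (sin ((a - b) / 2))\<^sup>2" by simp
    then show ?thesis
      by (simp add: power_mult_distrib flip: distrib_left)
  qed
  moreover have "dist (circ c r a) (circ c r b)
      = sqrt ((r * (cos a - cos b))\<^sup>2 + (r * (sin a - sin b))\<^sup>2)"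
    by (simp add: circ_def dist_prod_def dist_real_def flip: right_diff_distrib)
  ultimately show ?thesis
    using assms by (simp add: abs_mult)
qed

text \<open>The sine of half the angle grows until half a turn and is symmetric about it; hence two
  upper bounds, one for each arc cut off by \<open>u\<close> and \<open>v\<close>.\<close>

lemma dist_circ_mono:
  assumes "r > 0" and "\<bar>a - b\<bar> \<le> \<bar>u - v\<bar>" "\<bar>a - b\<bar> \<le> 2 * pi - \<bar>u - v\<bar>"
  shows "dist (circ c r a) (circ c r b) \<le> dist (circ c r u) (circ c r v)"
proof -
  define x y where "x = \<bar>a - b\<bar> / 2" and "y = \<bar>u - v\<bar> / 2"
  have xy: "0 \<le> x" "x \<le> y" "x \<le> pi - y" using assms by (auto simp: x_def y_def)
  have abs: "\<bar>sin (z / 2)\<bar> = sin (\<bar>z\<bar> / 2)" if "\<bar>z\<bar> / 2 \<le> pi" for z :: real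
    using that sin_ge_zero[of "\<bar>z\<bar> / 2"] by (auto simp: abs_if split: if_splits)
  have "sin x \<le> sin y"
  proof (cases "y \<le> pi / 2")
    case True
    then show ?thesis using xy by (intro sin_monotone_2pi_le) auto
  next
    case False
    have "sin x \<le> sin (pi - y)" using xy False by (intro sin_monotone_2pi_le) auto
    then show ?thesis by simp
  qed
  then have "\<bar>sin ((a - b) / 2)\<bar> \<le> \<bar>sin ((u - v) / 2)\<bar>"
    using xy abs[of "a - b"] abs[of "u - v"] by (simp add: x_def y_def)
  then show ?thesis using assms(1) by (simp add: dist_circ)
qed

text \<open>
  Signed distance, up to a positive factor, of \<open>p\<close> from the line through the points at the
  angles \<open>a\<close> and \<open>b\<close>; it is positive on the side of the open arc from \<open>a\<close> to \<open>b\<close>.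
\<close>

definition side :: "point \<Rightarrow> real \<Rightarrow> real \<Rightarrow> real \<Rightarrow> point \<Rightarrow> real" where
  "side c r a b p = (fst p - fst c) * cos ((a + b) / 2) + (snd p - snd c) * sin ((a + b) / 2)
     - r * cos ((a - b) / 2)"

lemma side_affine:
  "side c r a b ((1 - l) *\<^sub>R p + l *\<^sub>R q) = (1 - l) * side c r a b p + l * side c r a b q"
  by (simp add: side_def algebra_simps)

lemma side_circ:
  "side c r a b (circ c r t) = 2 * r * (sin ((t - a) / 2) * sin ((b - t) / 2))"
proof -
  have "side c r a b (circ c r t) = r * (cos (t - (a + b) / 2) - cos ((a - b) / 2))"
    by (simp add: side_def circ_def cos_diff[of t] algebra_simps)
  also have "cos (t - (a + b) / 2) - cos ((a - b) / 2) = 2 * (sin ((t - a) / 2) * sin ((b - t) / 2))"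
  proof -
    have *: "cos (x - y) - cos (x + y) = 2 * (sin x * sin y)" for x y :: real
      by (simp add: cos_diff cos_add)
    have "(t - a) / 2 - (b - t) / 2 = t - (a + b) / 2" "(t - a) / 2 + (b - t) / 2 = - ((a - b) / 2)"
      by (simp_all add: field_simps)
    with *[of "(t - a) / 2" "(b - t) / 2"] show ?thesis by (metis cos_minus)
  qed
  finally show ?thesis by simp
qed

lemma side_circ_ends [simp]: "side c r a b (circ c r a) = 0" "side c r a b (circ c r b) = 0"
  by (simp_all add: side_circ)

lemma side_circ_pos:
  assumes "r > 0" "a < t" "t < b" "b < a + 2 * pi"
  shows "side c r a b (circ c r t) > 0"
  using assms by (auto simp: side_circ intro!: mult_pos_pos sin_gt_zero)

lemma side_circ_neg:
  assumes "r > 0" "a < b" "b < t" "t < a + 2 * pi"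
  shows "side c r a b (circ c r t) < 0"
proof -
  have "sin ((t - a) / 2) > 0" "sin ((t - b) / 2) > 0" using assms by (auto intro!: sin_gt_zero)
  moreover have "sin ((b - t) / 2) = - sin ((t - b) / 2)"
    by (metis minus_diff_eq minus_divide_left sin_minus)
  ultimately show ?thesis using assms(1) by (simp add: side_circ)
qed

lemma side_circ_neg':
  assumes "r > 0" "t < a" "a < b" "b < t + 2 * pi"
  shows "side c r a b (circ c r t) < 0"
proof -
  have "sin ((b - t) / 2) > 0" "sin ((a - t) / 2) > 0" using assms by (auto intro!: sin_gt_zero)
  moreover have "sin ((t - a) / 2) = - sin ((a - t) / 2)"
    by (metis minus_diff_eq minus_divide_left sin_minus)
  ultimately show ?thesis using assms(1) by (simp add: side_circ)
qed

definition chord :: "point \<Rightarrow> real \<Rightarrow> real \<Rightarrow> real \<Rightarrow> point set" where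
  "chord c r a b = closed_segment (circ c r a) (circ c r b)"

lemma chord_commute: "chord c r a b = chord c r b a"
  by (simp add: chord_def closed_segment_commute)

text \<open>An affine function with one strict sign at both ends keeps it along the second chord,
  while it vanishes on the first.\<close>

lemma disjnt_chord_side:
  assumes "side c r a b (circ c r s) * side c r a b (circ c r t) > 0"
  shows "disjnt (chord c r a b) (chord c r s t)"
proof -
  let ?S = "side c r a b"
  have "?S p = 0" if "p \<in> chord c r a b" for p
    using that by (auto simp: chord_def in_segment side_affine)
  moreover have "?S p \<noteq> 0" if p: "p \<in> chord c r s t" for p
  proof -
    obtain l where l: "0 \<le> l" "l \<le> 1" "p = (1 - l) *\<^sub>R circ c r s + l *\<^sub>R circ c r t"
      using p by (auto simp: chord_def in_segment)
    then have S: "?S p = (1 - l) * ?S (circ c r s) + l * ?S (circ c r t)" by (simp add: side_affine)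
    from assms consider "?S (circ c r s) > 0" "?S (circ c r t) > 0" | "?S (circ c r s) < 0" "?S (circ c r t) < 0"
      by (auto simp: zero_less_mult_iff)
    then show ?thesis
    proof cases
      case 1
      then show ?thesis using S convex_bound_lt[of "- ?S (circ c r s)" 0 "- ?S (circ c r t)" "1 - l" l] l by simp
    next
      case 2
      then show ?thesis using S convex_bound_lt[of "?S (circ c r s)" 0 "?S (circ c r t)" "1 - l" l] l by simp
    qed
  qed
  ultimately show ?thesis by (auto simp: disjnt_def)
qed

text \<open>Each chord meets the line carrying the other, at \<open>X\<close> and at
  \<open>Y\<close>. Both points are on both lines, which are not parallel, so they coincide.\<close>

lemma chords_cross:
  assumes r: "r > 0" and "a < s" "s < b" "b < t" "t < a + 2 * pi"
  shows "\<not> disjnt (chord c r a b) (chord c r s t)"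
proof -
  let ?A = "circ c r a" and ?B = "circ c r b" and ?S = "circ c r s" and ?T = "circ c r t"
  have sg: "side c r a b ?S > 0" "side c r a b ?T < 0" "side c r s t ?A < 0" "side c r s t ?B > 0"
    using assms side_circ_pos[of r a s b] side_circ_neg[of r a b t] side_circ_neg'[of r a s t]
      side_circ_pos[of r s b t] by auto
  have root: "(1 - x / (x - y)) * x + x / (x - y) * y = 0" if "x \<noteq> y" for x y :: real
    using that by (simp add: field_simps)
  define l where "l = side c r s t ?A / (side c r s t ?A - side c r s t ?B)"
  define k where "k = side c r a b ?S / (side c r a b ?S - side c r a b ?T)"
  define X where "X = (1 - l) *\<^sub>R ?A + l *\<^sub>R ?B"
  define Y where "Y = (1 - k) *\<^sub>R ?S + k *\<^sub>R ?T"
  have lk: "0 \<le> l" "l \<le> 1" "0 \<le> k" "k \<le> 1"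
    using sg by (auto simp: l_def k_def divide_le_eq zero_le_divide_iff)
  have X0: "side c r a b X = 0" "side c r s t X = 0"
    using sg root[of "side c r s t ?A" "side c r s t ?B"] by (simp_all only: X_def side_affine) (auto simp: l_def)
  have Y0: "side c r a b Y = 0" "side c r s t Y = 0"
    using sg root[of "side c r a b ?S" "side c r a b ?T"] by (simp_all only: Y_def side_affine) (auto simp: k_def)
  let ?d1 = "fst X - fst Y" and ?d2 = "snd X - snd Y"
  have e1: "?d1 * cos ((a + b) / 2) + ?d2 * sin ((a + b) / 2) = 0"
    using X0(1) Y0(1) by (simp add: side_def algebra_simps)
  have e2: "?d1 * cos ((s + t) / 2) + ?d2 * sin ((s + t) / 2) = 0"
    using X0(2) Y0(2) by (simp add: side_def algebra_simps)
  \<comment> \<open>The half sums are the directions of the two normals, so \<open>D\<close> is the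
    sine of the angle between the lines.\<close>
  define D where "D = sin ((s + t) / 2 - (a + b) / 2)"
  have D: "D > 0" unfolding D_def using assms by (intro sin_gt_zero) (auto simp: field_simps)
  have D': "D = sin ((s + t) / 2) * cos ((a + b) / 2) - cos ((s + t) / 2) * sin ((a + b) / 2)"
    unfolding D_def by (rule sin_diff)
  have "?d1 * D = 0" "?d2 * D = 0"
    unfolding D' using e1 e2 by algebra+
  with D have "X = Y" by (auto simp: prod_eq_iff)
  moreover have "X \<in> chord c r a b" "Y \<in> chord c r s t"
    using lk by (auto simp: X_def Y_def chord_def in_segment)
  ultimately show ?thesis by (auto simp: disjnt_def)
qed

lemma disjnt_chords:
  assumes r: "r > 0" and "distinct [a, b, s, t]" and "a < b" "s < t"
    and "max b t < min a s + 2 * pi"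
    and "\<not> (a < s \<and> s < b \<and> b < t)" "\<not> (s < a \<and> a < t \<and> t < b)"
  shows "disjnt (chord c r a b) (chord c r s t)"
proof -
  have *: "disjnt (chord c r a b) (chord c r s t)"
    if "a < b" "s < t" "b < t" "distinct [a, b, s, t]" "t < a + 2 * pi" "t < s + 2 * pi" "\<not> (a < s \<and> s < b)" for a b s t
  proof -
    have "side c r a b (circ c r t) < 0" using that r by (intro side_circ_neg) auto
    moreover have "side c r a b (circ c r s) < 0"
      using that r side_circ_neg'[of r s a b] side_circ_neg[of r a b s] by (cases "s < a") auto
    ultimately show ?thesis by (intro disjnt_chord_side) (auto intro: mult_neg_neg)
  qed
  show ?thesis
  \<comment> \<open>The chord with the larger upper end serves as second chord in \<open>*\<close>:
    both its ends are then on the negative side of the other.\<close>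
  proof (cases "b < t")
    case True
    then show ?thesis using assms by (intro *) auto
  next
    case False
    then have "disjnt (chord c r s t) (chord c r a b)" using assms by (intro *) auto
    then show ?thesis by (rule disjnt_sym)
  qed
qed

subsection \<open>Optimal thresholds\<close>

definition pt :: "(point \<times> colour) list \<Rightarrow> nat \<Rightarrow> point" where
  "pt ps i = fst (ps ! i)"

definition is_red :: "(point \<times> colour) list \<Rightarrow> nat \<Rightarrow> bool" where
  "is_red ps i \<longleftrightarrow> snd (ps ! i) = Red"

text \<open>The walk starts at height \<open>length ps\<close>, so that the subtraction is never truncated.\<close>

primrec height :: "(point \<times> colour) list \<Rightarrow> nat \<Rightarrow> nat" where
  "height ps 0 = length ps"
| "height ps (Suc i) = (if is_red ps i then Suc (height ps i) else height ps i - 1)"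

lemma height_bounds: "length ps \<le> height ps i + i" "height ps i \<le> length ps + i"
  by (induction i) auto

lemma height_count:
  assumes "i \<le> length ps"
  shows "height ps i + count_list (map snd (take i ps)) Blue
    = length ps + count_list (map snd (take i ps)) Red"
  using assms
proof (induction i)
  case (Suc i)
  moreover have "height ps i > 0" using height_bounds(1)[of ps i] Suc.prems by simp
  moreover have "snd (ps ! i) = Red \<or> snd (ps ! i) = Blue" using colour.exhaust by blast
  ultimately show ?case by (auto simp: take_Suc_conv_app_nth is_red_def)
qed simp

lemma points_of_eq:
  "points_of Red ps = pt ps ` {i. i < length ps \<and> is_red ps i}"
  "points_of Blue ps = pt ps ` {i. i < length ps \<and> \<not> is_red ps i}"
proof -
  have *: "points_of k ps = pt ps ` {i. i < length ps \<and> snd (ps ! i) = k}" for k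
    by (auto simp: points_of_def pt_def in_set_conv_nth image_iff prod_eq_iff)
  show "points_of Red ps = pt ps ` {i. i < length ps \<and> is_red ps i}"
    by (simp add: * is_red_def)
  have "snd (ps ! i) = Blue \<longleftrightarrow> snd (ps ! i) \<noteq> Red" for i by (cases "snd (ps ! i)") auto
  then show "points_of Blue ps = pt ps ` {i. i < length ps \<and> \<not> is_red ps i}"
    by (simp add: * is_red_def)
qed

section \<open>Candidate matchings of points on a circle\<close>

locale circle_points =
  fixes ps :: "(point \<times> colour) list" and c :: point and r :: real and \<theta> :: "nat \<Rightarrow> real"
  assumes r_pos: "r > 0"
    and pt_circ: "i < length ps \<Longrightarrow> pt ps i = circ c r (\<theta> i)"
    and \<theta>_mono: "\<lbrakk>i < j; j < length ps\<rbrakk> \<Longrightarrow> \<theta> i < \<theta> j"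
    and \<theta>_bound: "\<lbrakk>i < length ps; j < length ps\<rbrakk> \<Longrightarrow> \<theta> i < \<theta> j + 2 * pi"
    and pt_inj: "\<lbrakk>i < length ps; j < length ps; pt ps i = pt ps j\<rbrakk> \<Longrightarrow> i = j"
    and height_end: "height ps (length ps) = length ps"
    and nonempty: "ps \<noteq> []"
begin

abbreviation "N \<equiv> length ps"

sublocale closed_walk N "is_red ps" "height ps"
proof
  fix i assume "i < N" "\<not> is_red ps i"
  then show "height ps i = Suc (height ps (Suc i))"
    using height_bounds(1)[of ps i] by simp
qed (simp_all add: height_end)

definition width :: "nat \<Rightarrow> real" where
  "width i = dist (pt ps (prd i)) (pt ps i)"

definition edge :: "nat \<Rightarrow> nat \<times> nat" where
  "edge i = (if is_red ps i then (i, prd i) else (prd i, i))"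

definition edges :: "nat \<Rightarrow> (nat \<times> nat) list" where
  "edges h = map edge (filter (head h) [0..<N])"

definition candidate :: "nat \<Rightarrow> (point \<times> point) set" where
  "candidate h = (\<lambda>(i, j). (pt ps i, pt ps j)) ` set (edges h)"

lemma candidate_eq: "candidate h = {(pt ps (fst (edge i)), pt ps (snd (edge i))) |i. i < N \<and> head h i}"
  by (auto simp: candidate_def edges_def image_iff case_prod_unfold)

lemma edge_set: "{fst (edge i), snd (edge i)} = {i, prd i}"
  by (auto simp: edge_def)

lemma edge_inj:
  assumes "i < N" "k < N" "head h i" "head h k" "{fst (edge i), snd (edge i)} \<inter> {fst (edge k), snd (edge k)} \<noteq> {}"
  shows "i = k"
  using assms head_covers[of i h] head_covers[of "prd i" h] prd_less[of i] unfolding edge_set by blast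

lemma represents_candidate: "represents ps (edges h) (candidate h)"
proof -
  have "inj_on edge {i. i < N \<and> head h i}"
    using edge_inj by (intro inj_onI) auto
  then have "distinct (edges h)"
    by (auto simp: edges_def distinct_map inj_on_def)
  moreover have "set (edges h) \<subseteq> {..<N} \<times> {..<N}"
    using prd_less by (auto simp: edges_def edge_def)
  ultimately show ?thesis
    by (simp add: represents_def candidate_def pt_def)
qed

lemma seg_chord: "\<lbrakk>i < N; j < N\<rbrakk> \<Longrightarrow> seg (pt ps i, pt ps j) = chord c r (\<theta> i) (\<theta> j)"
  by (simp add: seg_def chord_def pt_circ)

lemma is_matching_candidate: "is_matching (points_of Red ps) (points_of Blue ps) (candidate h)"
  unfolding is_matching_def
proof (intro conjI ballI)
  show "candidate h \<subseteq> points_of Red ps \<times> points_of Blue ps"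
    using prd_less red_prd by (auto simp: candidate_eq points_of_eq edge_def)
next
  fix p assume "p \<in> points_of Red ps \<union> points_of Blue ps"
  then obtain f where f: "f < N" "p = pt ps f" by (auto simp: points_of_eq)
  let ?e = "\<lambda>i. (pt ps (fst (edge i)), pt ps (snd (edge i)))"
  have mem: "p \<in> {fst (?e i), snd (?e i)} \<longleftrightarrow> f = i \<or> f = prd i" if i: "i < N" for i
    using f i prd_less[OF i] pt_inj[of f i] pt_inj[of f "prd i"] by (auto simp: edge_def)
  obtain i where i: "i < N" "head h i" "f = i \<or> f = prd i"
    and uniq: "\<And>k. \<lbrakk>k < N; head h k; f = k \<or> f = prd k\<rbrakk> \<Longrightarrow> k = i"
    using head_covers[OF f(1), of h] by blast
  show "\<exists>!e. e \<in> candidate h \<and> p \<in> {fst e, snd e}"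
  proof (rule ex1I[of _ "?e i"])
    show "?e i \<in> candidate h \<and> p \<in> {fst (?e i), snd (?e i)}"
      using i mem[OF i(1)] unfolding candidate_eq by blast
    fix e assume e: "e \<in> candidate h \<and> p \<in> {fst e, snd e}"
    then obtain k where k: "k < N" "head h k" "e = ?e k" unfolding candidate_eq by blast
    then have "k = i" using e mem[OF k(1)] uniq[OF k(1,2)] by blast
    with k show "e = ?e i" by simp
  qed
next
  have sorted: "\<exists>a b. a < b \<and> b < N \<and> {a, b} = {i, prd i} \<and>
      seg (pt ps (fst (edge i)), pt ps (snd (edge i))) = chord c r (\<theta> a) (\<theta> b)" if i: "i < N" for i
  proof -
    have "prd i \<noteq> i" using red_prd[OF i] by auto
    then have "min i (prd i) < max i (prd i)" "max i (prd i) < N" "{min i (prd i), max i (prd i)} = {i, prd i}"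
      using i prd_less[OF i] by (auto simp: min_def max_def)
    moreover have "seg (pt ps (fst (edge i)), pt ps (snd (edge i)))
        = chord c r (\<theta> (min i (prd i))) (\<theta> (max i (prd i)))"
      using i prd_less[OF i] chord_commute[of c r "\<theta> i" "\<theta> (prd i)"]
      by (auto simp: seg_chord edge_def min_def max_def)
    ultimately show ?thesis by blast
  qed
  show "pairwise (\<lambda>e f. disjnt (seg e) (seg f)) (candidate h)"
  proof (rule pairwiseI)
    fix e f assume "e \<in> candidate h" "f \<in> candidate h" "e \<noteq> f"
    then obtain i k where ik: "i < N" "head h i" "k < N" "head h k" "i \<noteq> k"
      and ef: "e = (pt ps (fst (edge i)), pt ps (snd (edge i)))"
        "f = (pt ps (fst (edge k)), pt ps (snd (edge k)))"
      unfolding candidate_eq by blast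
    obtain a b where ab: "a < b" "b < N" "{a, b} = {i, prd i}" "seg e = chord c r (\<theta> a) (\<theta> b)"
      using sorted[OF ik(1)] ef by blast
    obtain s t where st: "s < t" "t < N" "{s, t} = {k, prd k}" "seg f = chord c r (\<theta> s) (\<theta> t)"
      using sorted[OF ik(3)] ef by blast
    have "{a, b} \<inter> {s, t} = {}"
      using edge_inj[OF ik(1,3,2,4)] ik(5) unfolding edge_set ab(3) st(3) by blast
    then have distinct: "distinct [a, b, s, t]" using ab(1) st(1) by auto
    have less: "\<theta> x < \<theta> y \<longleftrightarrow> x < y" if "x < N" "y < N" for x y
      using \<theta>_mono[of x y] \<theta>_mono[of y x] that by (cases x y rule: linorder_cases) auto
    have \<theta>_eq: "\<theta> x = \<theta> y \<longleftrightarrow> x = y" if "x < N" "y < N" for x y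
      using less[of x y] less[of y x] that by (metis nat_neq_iff less_irrefl)
    have N: "a < N" "b < N" "s < N" "t < N" using ab st by auto
    have "disjnt (chord c r (\<theta> a) (\<theta> b)) (chord c r (\<theta> s) (\<theta> t))"
    proof (rule disjnt_chords[OF r_pos])
      show "distinct [\<theta> a, \<theta> b, \<theta> s, \<theta> t]" using distinct N by (simp add: \<theta>_eq)
      show "max (\<theta> b) (\<theta> t) < min (\<theta> a) (\<theta> s) + 2 * pi"
        using N \<theta>_bound by (simp add: max_def min_def)
      show "\<theta> a < \<theta> b" "\<theta> s < \<theta> t" using ab st by (simp_all add: \<theta>_mono)
      show "\<not> (\<theta> a < \<theta> s \<and> \<theta> s < \<theta> b \<and> \<theta> b < \<theta> t)"
        using heads_not_crossing[OF ik(1-4) ab(3) st(3)] N by (simp add: less)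
      show "\<not> (\<theta> s < \<theta> a \<and> \<theta> a < \<theta> t \<and> \<theta> t < \<theta> b)"
        using heads_not_crossing[OF ik(3,4,1,2) st(3) ab(3)] N by (simp add: less)
    qed
    then show "disjnt (seg e) (seg f)" using ab(4) st(4) by simp
  qed
qed

lemma bn_candidate_le:
  assumes "\<And>i. \<lbrakk>i < N; head h i\<rbrakk> \<Longrightarrow> width i \<le> t"
  shows "bn (candidate h) \<le> t"
proof -
  have N: "0 < N" using nonempty by simp
  have "candidate h \<noteq> {}" using head_covers[OF N, of h] unfolding candidate_eq by blast
  moreover have "finite (candidate h)" by (simp add: candidate_def)
  moreover have "dist (fst e) (snd e) \<le> t" if e: "e \<in> candidate h" for e
  proof -
    obtain i where i: "i < N" "head h i" "e = (pt ps (fst (edge i)), pt ps (snd (edge i)))"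
      using e unfolding candidate_eq by blast
    then have "dist (fst e) (snd e) = width i"
      by (simp add: width_def edge_def dist_commute)
    then show ?thesis using assms i by simp
  qed
  ultimately show ?thesis by (simp add: bn_def)
qed

text \<open>Translates an arbitrary matching into indices; by \<open>chords_cross\<close>,
  interleaved ends would give segments with a common point.\<close>

lemma matching_partner:
  assumes M: "is_matching (points_of Red ps) (points_of Blue ps) M"
  obtains m where "noncrossing_partner N (is_red ps) (height ps) m"
    and "\<And>i. i < N \<Longrightarrow> dist (pt ps i) (pt ps (m i)) \<le> bn M"
proof -
  define e where "e i j = (if is_red ps i then (pt ps i, pt ps j) else (pt ps j, pt ps i))" for i j
  have sub: "M \<subseteq> points_of Red ps \<times> points_of Blue ps"
    and ex1: "\<And>i. i < N \<Longrightarrow> \<exists>!e. e \<in> M \<and> pt ps i \<in> {fst e, snd e}"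
    and disj: "pairwise (\<lambda>e f. disjnt (seg e) (seg f)) M"
  proof -
    note M' = M[unfolded is_matching_def]
    show "M \<subseteq> points_of Red ps \<times> points_of Blue ps" by (rule M'[THEN conjunct1])
    show "pairwise (\<lambda>e f. disjnt (seg e) (seg f)) M" by (rule M'[THEN conjunct2, THEN conjunct2])
    fix i assume "i < N"
    then have "pt ps i \<in> points_of Red ps \<union> points_of Blue ps" by (auto simp: points_of_eq)
    then show "\<exists>!e. e \<in> M \<and> pt ps i \<in> {fst e, snd e}"
      by (rule M'[THEN conjunct2, THEN conjunct1, THEN bspec])
  qed
  have "\<exists>j. j < N \<and> (is_red ps j \<longleftrightarrow> \<not> is_red ps i) \<and> e i j \<in> M" if i: "i < N" for i
  proof -
    obtain x where x: "x \<in> M" "pt ps i \<in> {fst x, snd x}" using ex1[OF i] by (elim ex1E conjE)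
    then have "fst x \<in> points_of Red ps" "snd x \<in> points_of Blue ps" using sub by auto
    then obtain k l where kl: "k < N" "is_red ps k" "fst x = pt ps k" "l < N" "\<not> is_red ps l" "snd x = pt ps l"
      unfolding points_of_eq by blast
    then have "i = k \<or> i = l" using x(2) i pt_inj by auto
    moreover have "x = (pt ps k, pt ps l)" using kl by (simp add: prod_eq_iff)
    ultimately show ?thesis using x(1) kl by (auto simp: e_def)
  qed
  then obtain m where m: "\<And>i. i < N \<Longrightarrow> m i < N \<and> (is_red ps (m i) \<longleftrightarrow> \<not> is_red ps i) \<and> e i (m i) \<in> M"
    by metis
  have uniq: "x = y" if "x \<in> M" "y \<in> M" "i < N" "pt ps i \<in> {fst x, snd x}" "pt ps i \<in> {fst y, snd y}" for x y i
    using ex1[OF that(3)] that by (metis (no_types, lifting))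
  have e_ends: "{fst (e i j), snd (e i j)} = {pt ps i, pt ps j}" for i j by (auto simp: e_def)
  have m_m: "m (m i) = i" if i: "i < N" for i
  proof -
    have mi: "m i < N" "m (m i) < N" using m i by blast+
    have "e (m i) (m (m i)) = e i (m i)"
      using m[OF i] m[OF mi(1)] mi(1) by (intro uniq[of _ _ "m i"]) (simp_all add: e_ends)
    then have "pt ps (m (m i)) = pt ps i"
      using m[OF i] by (auto simp: e_def split: if_splits)
    then show ?thesis using pt_inj mi i by blast
  qed
  have "noncrossing_partner N (is_red ps) (height ps) m"
  proof
    fix a d assume *: "a < N" "d < N" "a < d" "d < m a" "m a < m d"
    have N: "m a < N" "m d < N" using m * by blast+
    have "e a (m a) \<noteq> e d (m d)"
    proof
      assume "e a (m a) = e d (m d)"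
      then have "pt ps d \<in> {pt ps a, pt ps (m a)}" using e_ends[of a "m a"] e_ends[of d "m d"] by auto
      then show False using pt_inj[of d a] pt_inj[of d "m a"] * N by auto
    qed
    then have "disjnt (seg (e a (m a))) (seg (e d (m d)))"
      using disj m * by (auto simp: pairwise_def)
    moreover have "seg (e a (m a)) = chord c r (\<theta> a) (\<theta> (m a))" "seg (e d (m d)) = chord c r (\<theta> d) (\<theta> (m d))"
      using * N by (auto simp: e_def seg_chord chord_commute)
    moreover have "\<not> disjnt (chord c r (\<theta> a) (\<theta> (m a))) (chord c r (\<theta> d) (\<theta> (m d)))"
      using * N \<theta>_mono \<theta>_bound by (intro chords_cross r_pos) auto
    ultimately show False by simp
  qed (use m m_m in blast)+
  moreover have "dist (pt ps i) (pt ps (m i)) \<le> bn M" if i: "i < N" for i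
  proof -
    have "finite M"
      using sub by (rule finite_subset) (simp add: points_of_eq)
    moreover have "dist (pt ps i) (pt ps (m i)) = dist (fst (e i (m i))) (snd (e i (m i)))"
      by (auto simp: e_def dist_commute)
    ultimately show ?thesis using m[OF i] by (auto simp: bn_def intro!: Max_ge)
  qed
  ultimately show ?thesis by (rule that)
qed

section \<open>Comparison of candidates with an arbitrary matching\<close>

lemma dist_pt_mono:
  assumes "i < N" "j < N" "u < N" "v < N"
    and "\<bar>\<theta> i - \<theta> j\<bar> \<le> \<bar>\<theta> u - \<theta> v\<bar>" "\<bar>\<theta> i - \<theta> j\<bar> \<le> 2 * pi - \<bar>\<theta> u - \<theta> v\<bar>"
  shows "dist (pt ps i) (pt ps j) \<le> dist (pt ps u) (pt ps v)"
  using assms by (simp add: pt_circ dist_circ_mono[OF r_pos])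

lemma \<theta>_mono_le: "\<lbrakk>i \<le> j; j < N\<rbrakk> \<Longrightarrow> \<theta> i \<le> \<theta> j"
  using \<theta>_mono[of i j] by (cases "i = j") auto

lemma threshold_exists:
  assumes M: "is_matching (points_of Red ps) (points_of Blue ps) M"
  shows "\<exists>h\<le>2 * N. \<forall>i<N. head h i \<longrightarrow> width i \<le> bn M"
proof -
  obtain m where "noncrossing_partner N (is_red ps) (height ps) m"
    and bn: "\<And>i. i < N \<Longrightarrow> dist (pt ps i) (pt ps (m i)) \<le> bn M"
    using matching_partner[OF M] by blast
  then interpret noncrossing_partner N "is_red ps" "height ps" m by simp
  have covered: "width i \<le> bn M"
    if "prd i < i" "i < N" "u \<le> prd i" "i \<le> m u" "m u < N" "\<theta> (m u) - \<theta> u \<le> pi" for i u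
  proof -
    have "\<theta> u \<le> \<theta> (prd i)" "\<theta> (prd i) < \<theta> i" "\<theta> i \<le> \<theta> (m u)"
      using that \<theta>_mono_le[of u "prd i"] \<theta>_mono[of "prd i" i] \<theta>_mono_le[of i "m u"] by auto
    then have "width i \<le> dist (pt ps u) (pt ps (m u))"
      unfolding width_def using that by (intro dist_pt_mono) auto
    also have "\<dots> \<le> bn M" using that by (intro bn) auto
    finally show ?thesis .
  qed
  \<comment> \<open>This says that the centre lies strictly on the side of the points between
    \<open>p\<close> and \<open>m p\<close>.\<close>
  define large where "large p \<longleftrightarrow> p < m p \<and> m p < N \<and> \<theta> (m p) - \<theta> p > pi" for p
  show ?thesis
  proof (cases "\<exists>p. large p")
    case False
    \<comment> \<open>The walk starts at height \<open>N\<close>, so this is the height at the cut,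
      and no selected head has an arc across it.\<close>
    have "width i \<le> bn M" if i: "i < N" "head N i" for i
    proof -
      have gap: "height ps g \<noteq> N" if "gap (prd i) i g" for g using head_gap_neq[OF i that] .
      have lt: "prd i < i" using gap[of 0] by (cases "prd i < i") (simp_all add: gap_def)
      have "\<exists>u. 0 \<le> u \<and> u \<le> prd i \<and> i \<le> m u \<and> m u < N"
        using lt i(1) m_less gap by (intro covering_edge[where h = N]) (auto simp: gap_def)
      then obtain u where u: "u \<le> prd i" "i \<le> m u" "m u < N" by blast
      moreover have "\<theta> (m u) - \<theta> u \<le> pi" using False u lt by (force simp: large_def)
      ultimately show ?thesis using covered[OF lt i(1)] by blast
    qed
    then show ?thesis by (intro exI[of _ N]) auto
  next
    case True
    \<comment> \<open>Minimal index span makes this edge innermost: edges strictly inside it span at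
      most half a turn.\<close>
    then obtain p where p: "large p" and least: "\<And>p'. large p' \<Longrightarrow> m p - p \<le> m p' - p'"
      using ex_has_least_nat[of large _ "\<lambda>p. m p - p"] by blast
    define q where "q = m p"
    have pq: "p < q" "q < N" "\<theta> q - \<theta> p > pi" using p by (auto simp: large_def q_def)
    define h where "h = height ps q"
    have h: "height ps (Suc p) = h" using balanced(1)[of p] pq by (simp add: h_def q_def)
    have "width i \<le> bn M" if i: "i < N" "head h i" for i
    proof -
      have gap: "height ps g \<noteq> h" if "gap (prd i) i g" for g using head_gap_neq[OF i that] .
      \<comment> \<open>These are the gaps next to both ends of the edge, on its inner side; since
        neither is spanned, the head's arc stays inside the edge or outside it.\<close>
      have "\<not> gap (prd i) i (Suc p)" "\<not> gap (prd i) i q"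
        using gap[of "Suc p"] gap[of q] h h_def by metis+
      then consider (inner) "p < prd i" "prd i < i" "i < q"
        | (outer) "prd i \<le> p \<or> q \<le> prd i" "i \<le> p \<or> q \<le> i"
        using pq i(1) prd_less[OF i(1)] by (cases "prd i < i") (simp_all add: gap_def, linarith+)
      then show ?thesis
      proof cases
        case inner
        have "\<exists>u. Suc p \<le> u \<and> u \<le> prd i \<and> i \<le> m u \<and> m u < q"
        proof (rule covering_edge)
          show "Suc p \<le> m f \<and> m f < q" if "Suc p \<le> f" "f < q" for f
            using m_between[of p f] that pq by (auto simp: q_def)
          show "height ps g \<noteq> h" if "prd i < g" "g \<le> i" for g
            using gap[of g] that inner by (simp add: gap_def)
        qed (use inner pq h in auto)
        then obtain u where u: "Suc p \<le> u" "u \<le> prd i" "i \<le> m u" "m u < q" by blast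
        moreover have "\<not> large u" using least[of u] u pq(1) by (auto simp: q_def)
        ultimately show ?thesis
          using covered[of i u] inner i(1) pq by (auto simp: large_def)
      next
        case outer
        have le: "\<theta> x \<le> \<theta> p" if "x \<le> p" for x using \<theta>_mono_le[OF that] pq by simp
        have ge: "\<theta> q \<le> \<theta> x" if "q \<le> x" "x < N" for x using \<theta>_mono_le[OF that] .
        have j: "prd i < N" using prd_less i by blast
        have same: "dist (pt ps x) (pt ps y) \<le> dist (pt ps p) (pt ps q)"
          if "x < N" "y < N" "x \<le> p \<and> y \<le> p \<or> q \<le> x \<and> q \<le> y" for x y
        proof -
          have "\<bar>\<theta> x - \<theta> y\<bar> \<le> 2 * pi - (\<theta> q - \<theta> p)"
            using that le[of x] le[of y] ge[of x] ge[of y] pq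
              \<theta>_bound[of q x] \<theta>_bound[of q y] \<theta>_bound[of x p] \<theta>_bound[of y p] by auto
          then show ?thesis using that pq by (intro dist_pt_mono) auto
        qed
        \<comment> \<open>Shifting \<open>x\<close> by a full turn makes the angles continuous
          across the cut.\<close>
        have opposite: "dist (pt ps x) (pt ps y) \<le> dist (pt ps p) (pt ps q)"
          if "x \<le> p" "q \<le> y" "y < N" for x y
        proof -
          have "dist (circ c r (\<theta> x + 2 * pi)) (circ c r (\<theta> y)) \<le> dist (circ c r (\<theta> p)) (circ c r (\<theta> q))"
            using that le[of x] ge[of y] \<theta>_bound[of y x] pq by (intro dist_circ_mono r_pos) auto
          then show ?thesis using that pq by (simp add: pt_circ circ_periodic)
        qed
        have "dist (pt ps (prd i)) (pt ps i) \<le> dist (pt ps p) (pt ps q)"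
          using outer same[OF j i(1)] opposite[of "prd i" i] opposite[of i "prd i"] j i(1)
          by (auto simp: dist_commute)
        then have "width i \<le> dist (pt ps p) (pt ps q)" by (simp add: width_def)
        also have "\<dots> \<le> bn M" using bn[of p] pq by (simp add: q_def)
        finally show ?thesis .
      qed
    qed
    moreover have "h \<le> 2 * N" using height_bounds(2)[of ps q] pq by (simp add: h_def)
    ultimately show ?thesis by blast
  qed
qed

end

subsection \<open>The program\<close>

text \<open>A functional form of \<open>step\<close>, which lets the simplifier execute code on a
  symbolic memory.\<close>

primrec run :: "program \<Rightarrow> nat \<Rightarrow> state \<Rightarrow> state option" where
  "run A 0 s = Some s"
| "run A (Suc t) s =
    (if pc s < length A then case exec (A ! pc s) s of None \<Rightarrow> None | Some s' \<Rightarrow> run A t s' else None)"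

lemma run_numeral [simp]:
  "run A (numeral k) s =
    (if pc s < length A
     then case exec (A ! pc s) s of None \<Rightarrow> None | Some s' \<Rightarrow> run A (pred_numeral k) s' else None)"
  by (simp add: numeral_eq_Suc)

text \<open>Only an upper bound, because the branches of a loop body differ in length.\<close>

definition reaches :: "program \<Rightarrow> nat \<Rightarrow> state \<Rightarrow> state \<Rightarrow> bool" where
  "reaches A b s s' \<longleftrightarrow> (\<exists>t\<le>b. (step A ^^ t) s s')"

lemma run_reaches: "run A t s = Some s' \<Longrightarrow> reaches A t s s'"
proof -
  assume "run A t s = Some s'"
  then have "(step A ^^ t) s s'"
  proof (induction t arbitrary: s)
    case (Suc t)
    then obtain u where "step A s u" "run A t u = Some s'"
      by (auto simp: step_def split: if_splits option.splits)
    with Suc.IH show ?case by (metis relpowp_Suc_I2)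
  qed simp
  then show ?thesis by (auto simp: reaches_def)
qed

lemma reaches_trans: "\<lbrakk>reaches A a s s'; reaches A b s' s''\<rbrakk> \<Longrightarrow> reaches A (a + b) s s''"
  unfolding reaches_def by (metis add_mono relpowp_trans)

lemma reaches_mono: "\<lbrakk>reaches A a s s'; a \<le> b\<rbrakk> \<Longrightarrow> reaches A b s s'"
  unfolding reaches_def by (meson le_trans)

lemma reaches_loop:
  assumes "\<And>i m. \<lbrakk>i < n; I i m\<rbrakk> \<Longrightarrow> \<exists>m'. reaches A b (S i m) (S (Suc i) m') \<and> I (Suc i) m'"
    and "I 0 m"
  shows "\<exists>m'. reaches A (n * b) (S 0 m) (S n m') \<and> I n m'"
  using assms(1)
proof (induction n)
  case 0
  then show ?case using assms(2) by (auto simp: reaches_def)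
next
  case (Suc n)
  have "\<exists>m'. reaches A (n * b) (S 0 m) (S n m') \<and> I n m'"
    by (rule Suc.IH) (simp add: Suc.prems)
  then obtain m' where m': "reaches A (n * b) (S 0 m) (S n m')" "I n m'" by blast
  obtain m'' where "reaches A b (S n m') (S (Suc n) m'')" "I (Suc n) m''"
    using Suc.prems[of n m'] m'(2) by blast
  with reaches_trans[OF m'(1)] show ?case by (auto simp: add.commute)
qed

text \<open>
  Address of field \<open>f\<close> of record \<open>j\<close>.  Fields 0 to 4 of record \<open>j\<close> describe point \<open>j\<close>:
  coordinates, colour, level, predecessor.  Fields 5 to 7 describe level \<open>j\<close>: the latest point
  seen, and the greatest widths of edges with a red and a blue head.  Points and levels are
  stored as pointers to field 0 of their records.  The cells below 16 are registers.
\<close>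

definition fld :: "nat \<Rightarrow> nat \<Rightarrow> nat" where
  "fld j f = 16 + 8 * j + f"

lemma fld_eq [simp]: "\<lbrakk>f < 8; g < 8\<rbrakk> \<Longrightarrow> fld j f = fld k g \<longleftrightarrow> j = k \<and> f = g"
  unfolding fld_def by auto arith+

lemma fld_register [simp]:
  "x < 16 \<Longrightarrow> fld j f \<noteq> x" "x < 16 \<Longrightarrow> x \<noteq> fld j f"
  by (auto simp: fld_def)

lemma fld_le [simp]: "fld i 0 \<le> fld j 0 \<longleftrightarrow> i \<le> j"
  by (auto simp: fld_def)

lemma fld_arith [simp]:
  "real (fld j 0) + 1 = real (fld j (Suc 0))"
  "real (fld j (Suc 0)) + 1 = real (fld j 2)"
  "real (fld j 2) + 1 = real (fld j 3)"
  "real (fld j 3) + 1 = real (fld j 4)"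
  "real (fld j 5) + 1 = real (fld j 6)"
  "real (fld j 6) + 1 = real (fld j 7)"
  "real (fld j 0) + 5 = real (fld j 5)"
  "real (fld j f) + 8 = real (fld (Suc j) f)"
  "real (fld (Suc j) f) - 8 = real (fld j f)"
  "real (fld (Suc j) 0) - 1 = real (fld j 7)"
  "2 * real (fld j 0) - real (fld 0 0) = real (fld (2 * j) 0)"
  "(real (fld j 0) - real (fld 0 0)) / 8 = real j"
  by (simp_all add: fld_def)

text \<open>Registers 0, 3, 5, 6 and 11 hold 0, 8, 1, 16 and 5; 1 is the cursor over the points, 2
  its end, and 4 the current height. Loops start at 9 (reading, levels), 29 (predecessors, widths),
  57 (narrowing, with the range in 7 and 8) and 70 (output, with the threshold in 7 and the index in
  8). The colour codes 0 and 1 serve as numbers: they update the height and choose between fields 6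
  and 7 without a branch.\<close>

definition prog :: program where
  "prog =
    [Read 1, Const 3 8, Const 5 1, Const 11 5, Const 6 16, Mul 2 1 3, Add 2 2 6, Copy 4 2,
     Copy 1 6,
     JumpLe 2 1 28, Read 7, Store 1 7, Add 8 1 5, Read 7, Store 8 7, Add 8 8 5, Read 7,
     Store 8 7, Mul 9 7 3, Sub 10 4 9, Add 8 8 5, Store 8 10, Add 4 10 3, Sub 4 4 9,
     Add 8 10 11, Store 8 1, Add 1 1 3, Jump 9,
     Copy 1 6,
     JumpLe 2 1 54, Copy 8 1, Load 12 8, Add 8 8 5, Load 13 8, Add 8 8 5, Load 7 8, Add 8 8 5,
     Load 10 8, Add 9 10 11, Load 14 9, Store 9 1, Add 8 8 5, Store 8 14, Load 15 14,
     Add 14 14 5, Load 14 14, Dist 15 15 14 12 13, Add 9 9 5, Add 9 9 7, Load 14 9,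
     JumpLe 15 14 52, Store 9 15, Add 1 1 3, Jump 29,
     Copy 7 6, Add 8 2 2, Sub 8 8 6,
     JumpLe 8 7 68, Add 9 7 11, Add 9 9 5, Load 9 9, Sub 10 8 5, Load 10 10, JumpLe 9 10 66,
     Sub 8 8 3, Jump 57, Add 7 7 3, Jump 57,
     Copy 1 6, Const 8 0,
     JumpLe 2 1 91, Add 9 1 5, Add 9 9 5, Load 10 9, Add 9 9 5, Load 12 9, Add 9 9 5,
     Load 13 9, Sub 13 13 6, Div 13 13 3, JumpLe 7 12 85, JumpLe 5 10 88, Write 8, Write 13,
     Jump 88, JumpLe 10 0 88, Write 13, Write 8, Add 1 1 3, Add 8 8 5, Jump 70,
     Halt]"

definition state_at :: "nat \<Rightarrow> (nat \<Rightarrow> real) \<Rightarrow> real list \<Rightarrow> real list \<Rightarrow> state" where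
  "state_at k m xs ys = \<lparr>pc = k, mem = m, inp = xs, out = ys\<rparr>"

lemma state_at_simps [simp]:
  "pc (state_at k m xs ys) = k" "mem (state_at k m xs ys) = m"
  "inp (state_at k m xs ys) = xs" "out (state_at k m xs ys) = ys"
  "put a v (state_at k m xs ys) = state_at (Suc k) (m(a := v)) xs ys"
  "(state_at k m xs ys)\<lparr>pc := l\<rparr> = state_at l m xs ys"
  "(state_at k m xs ys)\<lparr>inp := xs'\<rparr> = state_at k m xs' ys"
  "(state_at k m xs ys)\<lparr>out := ys'\<rparr> = state_at k m xs ys'"
  "(state_at k m xs ys)\<lparr>mem := m'\<rparr> = state_at k m' xs ys"
  "state_at k m xs ys = state_at k' m' xs' ys' \<longleftrightarrow> k = k' \<and> m = m' \<and> xs = xs' \<and> ys = ys'"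
  by (auto simp: state_at_def put_def)

lemma initial_eq: "initial xs = state_at 0 (\<lambda>_. 0) xs []"
  by (simp add: initial_def state_at_def)

lemma length_prog [simp]: "length prog = 92"
  by (simp add: prog_def)

text \<open>Yields one lookup equation per address, so that \<open>prog\<close> need not be unfolded
  for every instruction.\<close>

primrec listing :: "program \<Rightarrow> nat \<Rightarrow> program \<Rightarrow> bool" where
  "listing A k [] \<longleftrightarrow> True"
| "listing A k (c # cs) \<longleftrightarrow> A ! k = c \<and> listing A (Suc k) cs"

lemma listing_nth: "(\<And>i. i < length cs \<Longrightarrow> A ! (k + i) = cs ! i) \<Longrightarrow> listing A k cs"
proof (induction cs arbitrary: k)
  case (Cons c cs)
  from Cons.prems[of 0] Cons.prems[of "Suc _"] show ?case by (auto intro!: Cons.IH)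
qed simp

lemma listing_drop: "A = cs \<Longrightarrow> listing A k (drop k cs)"
  by (rule listing_nth) simp

lemmas prog_nth = listing_drop[OF prog_def, of 9, simplified]

context circle_points
begin

text \<open>The base value 0 is what untouched memory holds; it is harmless because widths are
  distances.\<close>

primrec widest :: "bool \<Rightarrow> nat \<Rightarrow> nat \<Rightarrow> real" where
  "widest b 0 l = 0"
| "widest b (Suc i) l =
    (if lev i = l \<and> is_red ps i = b then max (widest b i l) (width i) else widest b i l)"

lemma widest_le: "widest b n l \<le> t \<longleftrightarrow> 0 \<le> t \<and> (\<forall>i<n. lev i = l \<and> is_red ps i = b \<longrightarrow> width i \<le> t)"
  by (induction n) (auto simp: less_Suc_eq)

definition fits :: "real \<Rightarrow> nat \<Rightarrow> bool" where
  "fits t h \<longleftrightarrow> (\<forall>i<N. head h i \<longrightarrow> width i \<le> t)"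

lemma fits_nonneg: "fits t h \<Longrightarrow> 0 \<le> t"
proof -
  assume "fits t h"
  moreover obtain i where "i < N" "head h i"
    using head_covers[of 0 h] nonempty by blast
  ultimately have "width i \<le> t" by (simp add: fits_def)
  then show "0 \<le> t" using zero_le_dist order_trans unfolding width_def by blast
qed

text \<open>Raising the threshold only replaces the blue heads on level \<open>lo\<close> by red
  ones. The blue heads on level \<open>hi\<close> are already in use, so \<open>t\<close> bounds
  their widths and with them the red widths on \<open>lo\<close>.\<close>

lemma fits_raise:
  assumes fits: "fits t lo" and "lo \<le> hi" and le: "widest True N lo \<le> widest False N hi"
  shows "fits t (Suc lo)"
proof -
  have "widest False N hi \<le> t"
    using fits assms(2) fits_nonneg[OF fits] by (auto simp: widest_le fits_def head_def)
  with le have "widest True N lo \<le> t" by simp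
  then have "\<forall>i<N. lev i = lo \<and> is_red ps i \<longrightarrow> width i \<le> t" by (simp add: widest_le)
  then show ?thesis
    using fits by (auto simp: fits_def head_def Suc_le_eq order_less_le)
qed

text \<open>The mirror image: heads on level \<open>hi\<close> turn from red to blue, and the red
  heads on \<open>lo\<close> are already in use.\<close>

lemma fits_lower:
  assumes fits: "fits t (Suc hi)" and "lo \<le> hi" and le: "widest False N hi \<le> widest True N lo"
  shows "fits t hi"
proof -
  have "widest True N lo \<le> t"
    using fits assms(2) fits_nonneg[OF fits] by (auto simp: widest_le fits_def head_def)
  with le have "widest False N hi \<le> t" by simp
  then have "\<forall>i<N. lev i = hi \<and> \<not> is_red ps i \<longrightarrow> width i \<le> t" by (simp add: widest_le)
  then show ?thesis
    using fits by (auto simp: fits_def head_def Suc_le_eq order_less_le)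
qed

text \<open>Quantifying over every bound \<open>t\<close> keeps the optimum unmentioned: the range
  retains a threshold at least as good as any other.\<close>

definition bracket :: "nat \<Rightarrow> nat \<Rightarrow> bool" where
  "bracket lo hi \<longleftrightarrow> (\<forall>t h. h \<le> 2 * N \<longrightarrow> fits t h \<longrightarrow> (\<exists>h'. lo \<le> h' \<and> h' \<le> hi \<and> fits t h'))"

lemma bracket_raise:
  assumes "bracket lo hi" "lo < hi" "widest True N lo \<le> widest False N (hi - 1)"
  shows "bracket (Suc lo) hi"
  unfolding bracket_def
proof (intro allI impI)
  fix t h assume "h \<le> 2 * N" "fits t h"
  then obtain h' where h': "lo \<le> h'" "h' \<le> hi" "fits t h'" using assms(1) by (auto simp: bracket_def)
  show "\<exists>h'. Suc lo \<le> h' \<and> h' \<le> hi \<and> fits t h'"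
  proof (cases "h' = lo")
    case True
    then show ?thesis using fits_raise[of t lo "hi - 1"] h' assms by (intro exI[of _ "Suc lo"]) auto
  next
    case False
    then show ?thesis using h' by (intro exI[of _ h']) auto
  qed
qed

lemma bracket_lower:
  assumes "bracket lo (Suc hi)" "lo \<le> hi" "widest False N hi \<le> widest True N lo"
  shows "bracket lo hi"
  unfolding bracket_def
proof (intro allI impI)
  fix t h assume "h \<le> 2 * N" "fits t h"
  then obtain h' where h': "lo \<le> h'" "h' \<le> Suc hi" "fits t h'" using assms(1) by (auto simp: bracket_def)
  show "\<exists>h'. lo \<le> h' \<and> h' \<le> hi \<and> fits t h'"
  proof (cases "h' = Suc hi")
    case True
    then show ?thesis using fits_lower[of t hi lo] h' assms by (intro exI[of _ hi]) auto
  next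
    case False
    then show ?thesis using h' by (intro exI[of _ h']) auto
  qed
qed

section \<open>Memory invariants of the four loops\<close>

definition regs :: "(nat \<Rightarrow> real) \<Rightarrow> bool" where
  "regs m \<longleftrightarrow> m 0 = 0 \<and> m 2 = real (fld N 0) \<and> m 3 = 8 \<and> m 5 = 1 \<and> m 6 = real (fld 0 0) \<and> m 11 = 5"

definition points_stored :: "nat \<Rightarrow> (nat \<Rightarrow> real) \<Rightarrow> bool" where
  "points_stored n m \<longleftrightarrow> (\<forall>j<n. m (fld j 0) = fst (pt ps j) \<and> m (fld j (Suc 0)) = snd (pt ps j) \<and>
     m (fld j 2) = (if is_red ps j then 0 else 1) \<and> m (fld j 3) = real (fld (lev j) 0))"

text \<open>Field 5 is specified only for levels already seen, since elsewhere the cell is still 0,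
  which is not a pointer. Fields 6 and 7 must stay 0 as initial maxima for the next loop.\<close>

definition scan_inv :: "nat \<Rightarrow> (nat \<Rightarrow> real) \<Rightarrow> bool" where
  "scan_inv i m \<longleftrightarrow> regs m \<and> m (Suc 0) = real (fld i 0) \<and> m 4 = real (fld (height ps i) 0) \<and>
     points_stored i m \<and>
     (\<forall>j<i. m (fld (lev j) 5) = real (fld (latest lev (\<lambda>_. 0) i (lev j)) 0)) \<and>
     (\<forall>l. m (fld l 6) = 0 \<and> m (fld l 7) = 0)"

definition scan_state :: "nat \<Rightarrow> (nat \<Rightarrow> real) \<Rightarrow> state" where
  "scan_state i m = state_at 9 m (concat (map (\<lambda>((x, y), k). [x, y, colour_code k]) (drop i ps))) []"

lemma scan_start:
  "\<exists>m. run prog 9 (initial (encode_input ps)) = Some (scan_state 0 m) \<and> scan_inv 0 m"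
  by (simp add: initial_eq encode_input_def scan_state_def prog_def scan_inv_def regs_def
      points_stored_def fld_def)

lemma scan_step:
  assumes i: "i < N" and inv: "scan_inv i m"
  shows "\<exists>m'. run prog 19 (scan_state i m) = Some (scan_state (Suc i) m') \<and> scan_inv (Suc i) m'"
proof -
  obtain x y k where q: "ps ! i = ((x, y), k)" by (metis surj_pair)
  have drop: "drop i ps = ((x, y), k) # drop (Suc i) ps" using i q by (metis Cons_nth_drop_Suc)
  have m: "m 0 = 0" "m (Suc 0) = real (fld i 0)" "m 2 = real (fld N 0)" "m 3 = 8"
    "m 4 = real (fld (height ps i) 0)" "m 5 = 1" "m 6 = real (fld 0 0)" "m 11 = 5"
    using inv by (auto simp: scan_inv_def regs_def)
  show ?thesis
  proof (cases k)
    case Red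
    then have r: "is_red ps i" "lev i = height ps i" using q i lev_red[of i] by (auto simp: is_red_def)
    show ?thesis
      using i inv r Red
      by (simp add: scan_state_def drop prog_nth m Red)
        (auto simp: scan_inv_def regs_def points_stored_def less_Suc_eq q pt_def)
  next
    case Blue
    then have b: "\<not> is_red ps i" by (simp add: q is_red_def)
    obtain h where h: "height ps i = Suc h"
      using height_bounds(1)[of ps i] i by (cases "height ps i") auto
    then have l: "lev i = h" using b by (simp add: lev_def)
    show ?thesis
      using i inv b Blue l
      by (simp add: scan_state_def drop prog_nth m Blue h)
        (auto simp: scan_inv_def regs_def points_stored_def less_Suc_eq q pt_def h)
  qed
qed

definition preds_stored :: "nat \<Rightarrow> (nat \<Rightarrow> real) \<Rightarrow> bool" where
  "preds_stored n m \<longleftrightarrow> (\<forall>j<n. m (fld j 4) = real (fld (prd j) 0))"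

definition widths_stored :: "nat \<Rightarrow> (nat \<Rightarrow> real) \<Rightarrow> bool" where
  "widths_stored n m \<longleftrightarrow> (\<forall>l. m (fld l 6) = widest True n l \<and> m (fld l 7) = widest False n l)"

text \<open>Field 5 starts with the table left by the reading loop; updating it further produces the
  nested \<open>latest\<close> of \<open>prd\<close>.\<close>

definition link_inv :: "nat \<Rightarrow> (nat \<Rightarrow> real) \<Rightarrow> bool" where
  "link_inv i m \<longleftrightarrow> regs m \<and> m (Suc 0) = real (fld i 0) \<and> points_stored N m \<and> preds_stored i m \<and>
     (\<forall>j<N. m (fld (lev j) 5) = real (fld (latest lev (latest lev (\<lambda>_. 0) N) i (lev j)) 0)) \<and>
     widths_stored i m"

lemma link_start:
  assumes inv: "scan_inv N m"
  shows "\<exists>m'. run prog 2 (scan_state N m) = Some (state_at 29 m' [] []) \<and> link_inv 0 m'"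
proof -
  have m: "m (Suc 0) = real (fld N 0)" "m 2 = real (fld N 0)" "m 6 = real (fld 0 0)"
    using inv by (auto simp: scan_inv_def regs_def)
  show ?thesis
    using inv by (simp add: scan_state_def prog_nth m)
      (auto simp: scan_inv_def link_inv_def regs_def points_stored_def preds_stored_def
        widths_stored_def)
qed

lemma link_step:
  assumes i: "i < N" and inv: "link_inv i m"
  shows "\<exists>m'. reaches prog 25 (state_at 29 m [] []) (state_at 29 m' [] []) \<and> link_inv (Suc i) m'"
proof -
  define l where "l = lev i"
  have j: "prd i < N" by (rule prd_less[OF i])
  have m: "m 0 = 0" "m (Suc 0) = real (fld i 0)" "m 2 = real (fld N 0)" "m 3 = 8" "m 5 = 1"
    "m 6 = real (fld 0 0)" "m 11 = 5"
    "m (fld i 0) = fst (pt ps i)" "m (fld i (Suc 0)) = snd (pt ps i)"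
    "m (fld i 2) = (if is_red ps i then 0 else 1)" "m (fld i 3) = real (fld l 0)"
    "m (fld (prd i) 0) = fst (pt ps (prd i))" "m (fld (prd i) (Suc 0)) = snd (pt ps (prd i))"
    "m (fld l 5) = real (fld (prd i) 0)"
    "m (fld l 6) = widest True i l" "m (fld l 7) = widest False i l"
    using inv i j by (auto simp: link_inv_def regs_def points_stored_def widths_stored_def prd_def l_def)
  have w: "dist (pt ps (prd i)) (pt ps i) = width i" by (simp add: width_def)
  have "\<exists>t\<le>25. \<exists>m'. run prog t (state_at 29 m [] []) = Some (state_at 29 m' [] []) \<and> link_inv (Suc i) m'"
  proof (cases "is_red ps i")
    case r: True
    show ?thesis
    proof (cases "width i \<le> widest True i l")
      case le: True
      have "\<exists>m'. run prog 24 (state_at 29 m [] []) = Some (state_at 29 m' [] []) \<and> link_inv (Suc i) m'"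
        using r le i inv m(7-)
        by (simp add: prog_nth m w)
          (auto simp: link_inv_def regs_def points_stored_def preds_stored_def widths_stored_def
            less_Suc_eq l_def)
      then show ?thesis by (intro exI[of _ 24]) simp
    next
      case gt: False
      have "\<exists>m'. run prog 25 (state_at 29 m [] []) = Some (state_at 29 m' [] []) \<and> link_inv (Suc i) m'"
        using r gt i inv m(7-)
        by (simp add: prog_nth m w)
          (auto simp: link_inv_def regs_def points_stored_def preds_stored_def widths_stored_def
            less_Suc_eq l_def)
      then show ?thesis by (intro exI[of _ 25]) simp
    qed
  next
    case b: False
    show ?thesis
    proof (cases "width i \<le> widest False i l")
      case le: True
      have "\<exists>m'. run prog 24 (state_at 29 m [] []) = Some (state_at 29 m' [] []) \<and> link_inv (Suc i) m'"
        using b le i inv m(7-)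
        by (simp add: prog_nth m w)
          (auto simp: link_inv_def regs_def points_stored_def preds_stored_def widths_stored_def
            less_Suc_eq l_def)
      then show ?thesis by (intro exI[of _ 24]) simp
    next
      case gt: False
      have "\<exists>m'. run prog 25 (state_at 29 m [] []) = Some (state_at 29 m' [] []) \<and> link_inv (Suc i) m'"
        using b gt i inv m(7-)
        by (simp add: prog_nth m w)
          (auto simp: link_inv_def regs_def points_stored_def preds_stored_def widths_stored_def
            less_Suc_eq l_def)
      then show ?thesis by (intro exI[of _ 25]) simp
    qed
  qed
  then show ?thesis using run_reaches reaches_mono by blast
qed

text \<open>The equation says \<open>hi - lo = 2 * N - k\<close>: each round discards one threshold,
  and after \<open>2 * N\<close> rounds one is left.\<close>

definition narrow_inv :: "nat \<Rightarrow> (nat \<Rightarrow> real) \<Rightarrow> bool" where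
  "narrow_inv k m \<longleftrightarrow> regs m \<and> points_stored N m \<and> preds_stored N m \<and> widths_stored N m \<and>
     (\<exists>lo hi. m 7 = real (fld lo 0) \<and> m 8 = real (fld hi 0) \<and> hi + k = lo + 2 * N \<and> bracket lo hi)"

lemma narrow_start:
  assumes inv: "link_inv N m"
  shows "\<exists>m'. run prog 4 (state_at 29 m [] []) = Some (state_at 57 m' [] []) \<and> narrow_inv 0 m'"
proof -
  have m: "m (Suc 0) = real (fld N 0)" "m 2 = real (fld N 0)" "m 6 = real (fld 0 0)"
    using inv by (auto simp: link_inv_def regs_def)
  have "bracket 0 (2 * N)" by (auto simp: bracket_def)
  then show ?thesis
    using inv by (simp add: prog_nth m flip: mult_2)
      (auto simp: narrow_inv_def link_inv_def regs_def points_stored_def preds_stored_def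
        widths_stored_def intro!: exI[of _ 0] exI[of _ "2 * N"])
qed

lemma narrow_step:
  assumes k: "k < 2 * N" and inv: "narrow_inv k m"
  shows "\<exists>m'. run prog 9 (state_at 57 m [] []) = Some (state_at 57 m' [] []) \<and> narrow_inv (Suc k) m'"
proof -
  obtain lo hi where lohi: "m 7 = real (fld lo 0)" "m 8 = real (fld hi 0)" "hi + k = lo + 2 * N" "bracket lo hi"
    using inv unfolding narrow_inv_def by blast
  obtain g where g: "hi = Suc g" "lo \<le> g" using lohi(3) k by (cases hi) auto
  have m: "m 3 = 8" "m 5 = 1" "m 11 = 5" "m 7 = real (fld lo 0)" "m 8 = real (fld (Suc g) 0)"
    "m (fld lo 6) = widest True N lo" "m (fld g 7) = widest False N g"
    using inv lohi g by (auto simp: narrow_inv_def regs_def widths_stored_def)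
  have keep: "regs m" "points_stored N m" "preds_stored N m" "widths_stored N m"
    using inv by (auto simp: narrow_inv_def)
  show ?thesis
  proof (cases "widest True N lo \<le> widest False N g")
    case True
    then have "bracket (Suc lo) (Suc g)" using bracket_raise lohi(4) g by simp
    then have "narrow_inv (Suc k) (m(9 := widest True N lo, 10 := widest False N g, 7 := real (fld (Suc lo) 0)))"
      using keep lohi(3) g
      by (auto simp: narrow_inv_def regs_def points_stored_def preds_stored_def widths_stored_def m
        intro!: exI[of _ "Suc lo"] exI[of _ "Suc g"])
    then show ?thesis
      using g True by (simp add: prog_nth m)
  next
    case False
    then have "bracket lo g" using bracket_lower lohi(4) g by simp
    then have "narrow_inv (Suc k) (m(9 := widest True N lo, 10 := widest False N g, 8 := real (fld g 0)))"
      using keep lohi(3) g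
      by (auto simp: narrow_inv_def regs_def points_stored_def preds_stored_def widths_stored_def m
        intro!: exI[of _ lo] exI[of _ g])
    then show ?thesis
      using g False by (simp add: prog_nth m)
  qed
qed

definition emit_inv :: "nat \<Rightarrow> nat \<Rightarrow> (nat \<Rightarrow> real) \<Rightarrow> bool" where
  "emit_inv h i m \<longleftrightarrow> regs m \<and> points_stored N m \<and> preds_stored N m \<and>
     m (Suc 0) = real (fld i 0) \<and> m 7 = real (fld h 0) \<and> m 8 = real i"

definition emit_state :: "nat \<Rightarrow> nat \<Rightarrow> (nat \<Rightarrow> real) \<Rightarrow> state" where
  "emit_state h i m = state_at 70 m [] (encode_output (map edge (filter (head h) [0..<i])))"

lemma emit_start:
  assumes inv: "narrow_inv (2 * N) m"
  shows "\<exists>h m'. run prog 3 (state_at 57 m [] []) = Some (emit_state h 0 m') \<and> emit_inv h 0 m' \<and> bracket h h"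
proof -
  obtain h where h: "m 7 = real (fld h 0)" "m 8 = real (fld h 0)" "bracket h h"
    using inv unfolding narrow_inv_def by auto
  have m: "m 6 = real (fld 0 0)" using inv by (simp add: narrow_inv_def regs_def)
  have "emit_inv h 0 (m(Suc 0 := real (fld 0 0), 8 := 0))"
    using inv h by (auto simp: narrow_inv_def emit_inv_def regs_def points_stored_def preds_stored_def)
  then show ?thesis
    using h by (intro exI[of _ h] exI[of _ "m(Suc 0 := real (fld 0 0), 8 := 0)"])
      (simp add: prog_nth m emit_state_def encode_output_def)
qed

lemma emit_step:
  assumes i: "i < N" and inv: "emit_inv h i m"
  shows "\<exists>m'. reaches prog 18 (emit_state h i m) (emit_state h (Suc i) m') \<and> emit_inv h (Suc i) m'"
proof -
  have m: "m 0 = 0" "m (Suc 0) = real (fld i 0)" "m 2 = real (fld N 0)" "m 3 = 8" "m 5 = 1"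
    "m 6 = real (fld 0 0)" "m 7 = real (fld h 0)" "m 8 = real i"
    "m (fld i 2) = (if is_red ps i then 0 else 1)" "m (fld i 3) = real (fld (lev i) 0)"
    "m (fld i 4) = real (fld (prd i) 0)"
    using inv i by (auto simp: emit_inv_def regs_def points_stored_def preds_stored_def)
  \<comment> \<open>Register 9 ends as the address of field 4, and 13 holds the predecessor's
    pointer converted to an index.\<close>
  define m' where "m' = m(10 := m (fld i 2), 12 := real (fld (lev i) 0), 9 := real (fld i 4),
    13 := real (prd i), Suc 0 := real (fld (Suc i) 0), 8 := real i + 1)"
  have inv': "emit_inv h (Suc i) m'"
    using inv by (simp add: m'_def emit_inv_def regs_def points_stored_def preds_stored_def)
  have "\<exists>t\<le>18. run prog t (emit_state h i m) = Some (emit_state h (Suc i) m')"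
  proof (cases "h \<le> lev i"; cases "is_red ps i")
    assume "h \<le> lev i" "is_red ps i"
    then have "run prog 15 (emit_state h i m) = Some (emit_state h (Suc i) m')"
      using i by (simp add: emit_state_def encode_output_def prog_nth m head_def edge_def m'_def)
    then show ?thesis by (intro exI[of _ 15]) simp
  next
    assume "h \<le> lev i" "\<not> is_red ps i"
    then have "run prog 17 (emit_state h i m) = Some (emit_state h (Suc i) m')"
      using i by (simp add: emit_state_def encode_output_def prog_nth m head_def edge_def m'_def)
    then show ?thesis by (intro exI[of _ 17]) simp
  next
    assume "\<not> h \<le> lev i" "is_red ps i"
    then have "run prog 18 (emit_state h i m) = Some (emit_state h (Suc i) m')"
      using i by (simp add: emit_state_def encode_output_def prog_nth m head_def edge_def m'_def)
    then show ?thesis by (intro exI[of _ 18]) simp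
  next
    assume "\<not> h \<le> lev i" "\<not> is_red ps i"
    then have "run prog 15 (emit_state h i m) = Some (emit_state h (Suc i) m')"
      using i by (simp add: emit_state_def encode_output_def prog_nth m head_def edge_def m'_def)
    then show ?thesis by (intro exI[of _ 15]) simp
  qed
  with inv' show ?thesis using run_reaches reaches_mono by blast
qed

lemma emit_end:
  assumes "emit_inv h N m"
  shows "run prog 1 (emit_state h N m) = Some (state_at 91 m [] (encode_output (edges h)))"
  using assms by (simp add: emit_state_def emit_inv_def regs_def prog_nth edges_def)

text \<open>A better matching would, by \<open>threshold_exists\<close>, give a threshold fitting
  its value, and the bracket passes this on to its only member \<open>h\<close>.\<close>

lemma candidate_bottleneck:
  assumes "bracket h h"
  shows "is_bottleneck_matching (points_of Red ps) (points_of Blue ps) (candidate h)"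
  unfolding is_bottleneck_matching_def is_arg_min_def
proof (intro conjI notI)
  show "is_matching (points_of Red ps) (points_of Blue ps) (candidate h)"
    by (rule is_matching_candidate)
  assume "\<exists>M. is_matching (points_of Red ps) (points_of Blue ps) M \<and> bn M < bn (candidate h)"
  then obtain M where M: "is_matching (points_of Red ps) (points_of Blue ps) M" "bn M < bn (candidate h)"
    by blast
  obtain h' where "h' \<le> 2 * N" "fits (bn M) h'"
    using threshold_exists[OF M(1)] by (auto simp: fits_def)
  with assms have "fits (bn M) h" unfolding bracket_def by (metis le_antisym)
  then have "bn (candidate h) \<le> bn M" by (intro bn_candidate_le) (simp add: fits_def)
  with M(2) show False by simp
qed

text \<open>Per point 19 steps for reading, 25 for linking, \<open>2 * 9\<close> for narrowing and
  18 for output; setup and transitions add \<open>9 + 2 + 4 + 3 + 1\<close>.\<close>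

lemma solves: "\<exists>t\<le>19 + 80 * N. solves_bottleneck_in prog ps t"
proof -
  obtain m0 where m0: "run prog 9 (initial (encode_input ps)) = Some (scan_state 0 m0)" "scan_inv 0 m0"
    using scan_start by blast
  have "\<exists>m. reaches prog (N * 19) (scan_state 0 m0) (scan_state N m) \<and> scan_inv N m"
    by (rule reaches_loop[where S = scan_state and I = scan_inv, OF _ m0(2)])
      (metis scan_step run_reaches)
  then obtain m1 where m1: "reaches prog (N * 19) (scan_state 0 m0) (scan_state N m1)" "scan_inv N m1"
    by blast
  obtain m2 where m2: "run prog 2 (scan_state N m1) = Some (state_at 29 m2 [] [])" "link_inv 0 m2"
    using link_start[OF m1(2)] by blast
  have "\<exists>m. reaches prog (N * 25) (state_at 29 m2 [] []) (state_at 29 m [] []) \<and> link_inv N m"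
    by (rule reaches_loop[where S = "\<lambda>i m. state_at 29 m [] []" and I = link_inv, OF _ m2(2)])
      (rule link_step)
  then obtain m3 where m3: "reaches prog (N * 25) (state_at 29 m2 [] []) (state_at 29 m3 [] [])" "link_inv N m3"
    by blast
  obtain m4 where m4: "run prog 4 (state_at 29 m3 [] []) = Some (state_at 57 m4 [] [])" "narrow_inv 0 m4"
    using narrow_start[OF m3(2)] by blast
  have "\<exists>m. reaches prog (2 * N * 9) (state_at 57 m4 [] []) (state_at 57 m [] []) \<and> narrow_inv (2 * N) m"
    by (rule reaches_loop[where S = "\<lambda>i m. state_at 57 m [] []" and I = narrow_inv, OF _ m4(2)])
      (metis narrow_step run_reaches)
  then obtain m5 where m5: "reaches prog (2 * N * 9) (state_at 57 m4 [] []) (state_at 57 m5 [] [])"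
      "narrow_inv (2 * N) m5"
    by blast
  obtain h m6 where m6: "run prog 3 (state_at 57 m5 [] []) = Some (emit_state h 0 m6)" "emit_inv h 0 m6"
    and h: "bracket h h"
    using emit_start[OF m5(2)] by blast
  have "\<exists>m. reaches prog (N * 18) (emit_state h 0 m6) (emit_state h N m) \<and> emit_inv h N m"
    by (rule reaches_loop[where S = "emit_state h" and I = "emit_inv h", OF _ m6(2)])
      (rule emit_step)
  then obtain m7 where m7: "reaches prog (N * 18) (emit_state h 0 m6) (emit_state h N m7)" "emit_inv h N m7"
    by blast
  have "reaches prog (9 + N * 19 + 2 + N * 25 + 4 + 2 * N * 9 + 3 + N * 18 + 1) (initial (encode_input ps))
      (state_at 91 m7 [] (encode_output (edges h)))"
    by (intro reaches_trans[OF _ run_reaches[OF emit_end[OF m7(2)]]] reaches_trans[OF _ m7(1)]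
        reaches_trans[OF _ run_reaches[OF m6(1)]] reaches_trans[OF _ m5(1)]
        reaches_trans[OF _ run_reaches[OF m4(1)]] reaches_trans[OF _ m3(1)]
        reaches_trans[OF _ run_reaches[OF m2(1)]] reaches_trans[OF _ m1(1)]
        run_reaches[OF m0(1)])
  then obtain t where t: "t \<le> 19 + 80 * N"
    "(step prog ^^ t) (initial (encode_input ps)) (state_at 91 m7 [] (encode_output (edges h)))"
    by (auto simp: reaches_def)
  then have "computes_in prog (encode_input ps) t (encode_output (edges h))"
    by (auto simp: computes_in_def prog_nth)
  then have "solves_bottleneck_in prog ps t"
    using represents_candidate candidate_bottleneck[OF h] unfolding solves_bottleneck_in_def by blast
  with t(1) show ?thesis by blast
qed

end

lemma valid_instance_circle_points:
  assumes "valid_instance n ps" "n \<ge> 1"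
  shows "\<exists>c r \<theta>. circle_points ps c r \<theta>"
proof -
  have len: "length ps = 2 * n" and dist: "distinct (map fst ps)"
    and count: "count_list (map snd ps) Red = n" "count_list (map snd ps) Blue = n"
    and ccw: "ccw_on_circle (map fst ps)"
    using assms(1) by (auto simp: valid_instance_def)
  obtain c r \<theta> where r: "r > 0"
    and circ: "\<And>i. i < length ps \<Longrightarrow> fst (ps ! i) = c + r *\<^sub>R (cos (\<theta> i), sin (\<theta> i))"
    and mono: "strict_mono_on {..<length ps} \<theta>"
    and bound: "\<And>i. i < length ps \<Longrightarrow> \<theta> i < \<theta> 0 + 2 * pi"
    using ccw by (auto simp: ccw_on_circle_def)
  have "circle_points ps c r \<theta>"
  proof
    show "\<theta> i < \<theta> j" if "i < j" "j < length ps" for i j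
      using strict_mono_onD[OF mono, of i j] that by simp
    \<comment> \<open>As \<open>\<theta> 0\<close> is the least angle, the bound relative to it
      carries over to any two angles.\<close>
    then have "\<theta> 0 \<le> \<theta> j" if "j < length ps" for j
      using that by (cases "j = 0") (auto intro: less_imp_le)
    then show "\<theta> i < \<theta> j + 2 * pi" if "i < length ps" "j < length ps" for i j
      using bound[OF that(1)] that(2) by (meson add_le_cancel_right less_le_trans)
    show "i = j" if "i < length ps" "j < length ps" "pt ps i = pt ps j" for i j
      using that nth_eq_iff_index_eq[OF dist, of i j] by (simp add: pt_def)
    show "height ps (length ps) = length ps"
      using height_count[of "length ps" ps] count by simp
    show "ps \<noteq> []" using len assms(2) by auto
  qed (use r circ in \<open>auto simp: pt_def circ_def\<close>)
  then show ?thesis by blast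
qed

theorem theorem34:
  shows "\<exists>(A :: program) (T :: nat \<Rightarrow> nat).
           (\<lambda>n. real (T n)) \<in> O(\<lambda>n. real n) \<and>
           (\<forall>n\<ge>1. \<forall>ps. valid_instance n ps \<longrightarrow>
              (\<exists>t\<le>T n. solves_bottleneck_in A ps t))"
proof (rule exI[of _ prog], rule exI[of _ "\<lambda>n. 200 * n"], intro conjI allI impI)
  show "(\<lambda>n. real (200 * n)) \<in> O(\<lambda>n. real n)" by simp
  fix n ps assume n: "n \<ge> (1 :: nat)" and valid: "valid_instance n ps"
  then obtain c r \<theta> where "circle_points ps c r \<theta>"
    using valid_instance_circle_points by blast
  then obtain t where "t \<le> 19 + 80 * length ps" "solves_bottleneck_in prog ps t"
    using circle_points.solves by blast
  moreover have "length ps = 2 * n" using valid by (simp add: valid_instance_def)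
  \<comment> \<open>The count is \<open>19 + 160 * n\<close>, and \<open>n \<ge> 1\<close> absorbs
    the constant.\<close>
  ultimately show "\<exists>t\<le>200 * n. solves_bottleneck_in prog ps t"
    using n by (intro exI[of _ t]) auto
qed

end
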